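(* Let $\omega\subset\mathbb{R}^2$ be a bounded convex open set such that $\omega\neq\mathbb{R}^2$. Assume that the set $V(\omega)=V_H(\omega)\times V_3(\omega)$, where $V_H(\omega)\subset H^1(\omega)\times H^1(\omega)$ and $V_3(\omega)\subset H^2(\omega)$, satisfies the following two conditions: $$(u_\alpha)\in V_H(\omega)\ \text{ and }\ \partial_\alpha u_\beta+\partial_\beta u_\alpha=0\text{ in }\omega \text{ for all }\alpha,\beta\in\{1,2\}\quad\text{imply}\quad u_\alpha=0\text{ in }\omega \text{ for all }\alpha\in\{1,2\},$$ and $$u_3\in V_3(\omega)\quad\text{implies}\quad u_3=0\text{ on }\partial\omega.$$ Then the set $V(\omega)$ satisfies both of the following properties: $$u_3\in V_3(\omega)\ \text{ and }\ \partial_{\alpha\beta}u_3=0\text{ in }\omega \text{ for all }\alpha,\beta\in\{1,2\}\quad\text{imply}\quad u_3=0\text{ in }\omega,$$ and $$\boldsymbol{u}\in V(\omega)\ \text{ and }\ \boldsymbol{E}(\boldsymbol{u})=\boldsymbol{0}\text{ in }\omega\quad\text{imply}\quad\boldsymbol{u}=\boldsymbol{0}\text{ in }\omega.$$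
   Context: For $\boldsymbol{u}=(u_1,u_2,u_3)\in H^1(\omega)\times H^1(\omega)\times H^2(\omega)$, the symmetric matrix field $\boldsymbol{E}(\boldsymbol{u})=(E_{\alpha\beta}(\boldsymbol{u}))_{\alpha,\beta\in\{1,2\}}$ is defined by $$E_{\alpha\beta}(\boldsymbol{u})=\tfrac12(\partial_\alpha u_\beta+\partial_\beta u_\alpha+\partial_\alpha u_3\,\partial_\beta u_3),$$ where $\partial_\alpha=\partial/\partial y_\alpha$ and $\partial_{\alpha\beta}=\partial^2/\partial y_\alpha\partial y_\beta$ are distributional derivatives. Boundary values are understood in the sense of traces (so $u_3\in H^2(\omega)$ with $u_3=0$ on $\partial\omega$ means $u_3\in H^2(\omega)\cap H^1_0(\omega)$). *)

theory Defs
  imports "HOL-Analysis.Analysis"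
begin

section \<open>Test functions\<close>

definition pderiv_at :: "'n::finite \<Rightarrow> (real^'n \<Rightarrow> real) \<Rightarrow> real^'n \<Rightarrow> real"
  where "pderiv_at i f x = frechet_derivative f (at x) (axis i 1)"

definition smooth_fun :: "(real^'n::finite \<Rightarrow> real) \<Rightarrow> bool"
  where "smooth_fun f \<longleftrightarrow> (\<forall>is. foldr pderiv_at is f differentiable_on UNIV)"

definition test_funs :: "(real^'n::finite) set \<Rightarrow> (real^'n \<Rightarrow> real) set"
  where "test_funs \<omega> = {\<phi>. smooth_fun \<phi> \<and> compact (closure (support_on UNIV \<phi>))
                          \<and> closure (support_on UNIV \<phi>) \<subseteq> \<omega>}"


section \<open>Sobolev spaces\<close>

text \<open>
  Elements of the function spaces below are representatives, defined on the whole of the Euclidean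
  space, of classes of functions on \<open>\<omega>\<close> modulo equality almost everywhere in \<open>\<omega>\<close>; the values
  outside \<open>\<omega>\<close> play no role. Accordingly, equality in \<open>\<omega>\<close> is equality almost everywhere.
\<close>

definition L2 :: "(real^'n::finite) set \<Rightarrow> (real^'n \<Rightarrow> real) set"
  where "L2 \<omega> = {f. f \<in> borel_measurable (lebesgue_on \<omega>)
                    \<and> integrable (lebesgue_on \<omega>) (\<lambda>x. (f x)\<^sup>2)}"

definition L2_norm :: "(real^'n::finite) set \<Rightarrow> (real^'n \<Rightarrow> real) \<Rightarrow> real"
  where "L2_norm \<omega> f = sqrt (integral\<^sup>L (lebesgue_on \<omega>) (\<lambda>x. (f x)\<^sup>2))"

definition has_L2_weak_partial ::
    "(real^'n::finite) set \<Rightarrow> 'n \<Rightarrow> (real^'n \<Rightarrow> real) \<Rightarrow> (real^'n \<Rightarrow> real) \<Rightarrow> bool"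
  where "has_L2_weak_partial \<omega> i u g \<longleftrightarrow> u \<in> L2 \<omega> \<and> g \<in> L2 \<omega> \<and>
    (\<forall>\<phi>\<in>test_funs \<omega>. integral\<^sup>L (lebesgue_on \<omega>) (\<lambda>x. u x * pderiv_at i \<phi> x)
                   = - integral\<^sup>L (lebesgue_on \<omega>) (\<lambda>x. g x * \<phi> x))"

text \<open>
  For open \<open>\<omega>\<close>, the distributional partial derivative is unique up to equality almost everywhere
  in \<open>\<omega>\<close>; \<open>weak_partial\<close> selects a representative. It is only meaningful if the derivative exists
  in \<open>L2 \<omega>\<close>, as it does for all functions in \<open>H1 \<omega>\<close>.
\<close>

definition weak_partial :: "(real^'n::finite) set \<Rightarrow> 'n \<Rightarrow> (real^'n \<Rightarrow> real) \<Rightarrow> (real^'n \<Rightarrow> real)"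
  where "weak_partial \<omega> i u = (SOME g. has_L2_weak_partial \<omega> i u g)"

definition H1 :: "(real^'n::finite) set \<Rightarrow> (real^'n \<Rightarrow> real) set"
  where "H1 \<omega> = {u \<in> L2 \<omega>. \<forall>i. \<exists>g. has_L2_weak_partial \<omega> i u g}"

lemma has_L2_weak_partial_weak_partial:
  assumes "u \<in> H1 \<omega>"
  shows "has_L2_weak_partial \<omega> i u (weak_partial \<omega> i u)"
  using assms unfolding H1_def weak_partial_def by (simp add: some_eq_ex)

definition H2 :: "(real^'n::finite) set \<Rightarrow> (real^'n \<Rightarrow> real) set"
  where "H2 \<omega> = {u \<in> H1 \<omega>. \<forall>i. weak_partial \<omega> i u \<in> H1 \<omega>}"

text \<open>
  \<open>H10 \<omega>\<close> is the closure of the test functions with respect to the norm of \<open>H1 \<omega>\<close>. Membership is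
  the meaning of \<open>u = 0\<close> on the boundary of \<open>\<omega>\<close> in the sense of traces.
\<close>

definition H10 :: "(real^'n::finite) set \<Rightarrow> (real^'n \<Rightarrow> real) set"
  where "H10 \<omega> = {u \<in> H1 \<omega>. \<exists>\<phi>. (\<forall>n::nat. \<phi> n \<in> test_funs \<omega>)
      \<and> (\<lambda>n. L2_norm \<omega> (\<lambda>x. u x - \<phi> n x)) \<longlonglongrightarrow> 0
      \<and> (\<forall>i. (\<lambda>n. L2_norm \<omega> (\<lambda>x. weak_partial \<omega> i u x - pderiv_at i (\<phi> n) x)) \<longlonglongrightarrow> 0)}"

definition zero_in :: "(real^'n::finite) set \<Rightarrow> (real^'n \<Rightarrow> 'b::zero) \<Rightarrow> bool"
  where "zero_in \<omega> f \<longleftrightarrow> (AE x in lebesgue_on \<omega>. f x = 0)"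


section \<open>The nonlinear strain\<close>

text \<open>A displacement \<open>(u\<^sub>1, u\<^sub>2, u\<^sub>3)\<close> is represented as the pair of \<open>(u\<^sub>\<alpha>)\<close> and \<open>u\<^sub>3\<close>.\<close>

type_synonym displacement = "(2 \<Rightarrow> real^2 \<Rightarrow> real) \<times> (real^2 \<Rightarrow> real)"

definition strain :: "(real^2) set \<Rightarrow> displacement \<Rightarrow> real^2 \<Rightarrow> real^2^2"
  where "strain \<omega> u x = (case u of (uH, u3) \<Rightarrow>
    (\<chi> \<alpha> \<beta>. 1/2 * (weak_partial \<omega> \<alpha> (uH \<beta>) x + weak_partial \<omega> \<beta> (uH \<alpha>) x
                  + weak_partial \<omega> \<alpha> u3 x * weak_partial \<omega> \<beta> u3 x)))"

end

theory Submission
  imports Defs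
begin

text \<open>
  Eliminating the in-plane components from \<open>E(u) = 0\<close> gives \<open>det (D\<^sup>2 w) = 0\<close> for \<open>w = u\<^sub>3\<close> in the very weak
  form \<open>Q(\<phi>) = \<integral> cof (D\<^sup>2 \<phi>) \<nabla>w \<cdot> \<nabla>w = 0\<close> for all test functions \<open>\<phi>\<close>. Approximating one factor \<open>\<nabla>w\<close> by
  gradients of test functions yields \<open>Q(\<psi>) = \<integral> G \<cdot> \<nabla>\<psi>\<close> with the integrable field \<open>G = cof (D\<^sup>2 w) \<nabla>w\<close>, for
  every smooth \<open>\<psi>\<close>, compactly supported or not. Since \<open>\<omega>\<close> is convex, there are smooth concave functions
  \<open>S\<^sub>n\<close> with uniformly bounded gradients that stay above a positive limit inside \<open>\<omega>\<close>, are at most \<open>1/n\<close> at the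
  boundary and are uniformly concave off a boundary layer. Cutting off small values of \<open>S\<^sub>n\<close> turns it into a test
  function at the cost of an integral of \<open>G\<close> over a shrinking set, so \<open>Q(S\<^sub>n)\<close> tends to \<open>0\<close>; by concavity
  \<open>- Q(S\<^sub>n)\<close> dominates \<open>\<integral> |\<nabla>w|\<^sup>2 / 2\<close> off the layer. Hence \<open>\<nabla>w = 0\<close>, so \<open>w = 0\<close>, and the
  in-plane components vanish by the hypothesis on \<open>V\<^sub>H\<close>.
\<close>

section \<open>Smooth functions\<close>

lemma has_derivative_pderiv_at:
  assumes "(f has_derivative f') (at x)"
  shows "pderiv_at i f x = f' (axis i 1)"
  using frechet_derivative_at[OF assms] by (simp add: pderiv_at_def)

lemma pderiv_at_const: "pderiv_at i (\<lambda>x. c) x = 0"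
  using has_derivative_pderiv_at[OF has_derivative_const] .

lemma pderiv_at_add:
  assumes "f differentiable at x" "g differentiable at x"
  shows "pderiv_at i (\<lambda>x. f x + g x) x = pderiv_at i f x + pderiv_at i g x"
  using has_derivative_pderiv_at[OF has_derivative_add[OF
      assms(1)[unfolded frechet_derivative_works] assms(2)[unfolded frechet_derivative_works]]]
  by (simp add: pderiv_at_def)

lemma pderiv_at_mult:
  assumes "f differentiable at x" "g differentiable at x"
  shows "pderiv_at i (\<lambda>x. f x * g x) x = f x * pderiv_at i g x + pderiv_at i f x * g x"
  using has_derivative_pderiv_at[OF has_derivative_mult[OF
      assms(1)[unfolded frechet_derivative_works] assms(2)[unfolded frechet_derivative_works]]]
  by (simp add: pderiv_at_def)

lemma has_derivative_real_comp:
  assumes "f differentiable at x" "(h has_real_derivative d) (at (f x))"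
  shows "((\<lambda>x. h (f x)) has_derivative (\<lambda>v. d * frechet_derivative f (at x) v)) (at x)"
  using has_derivative_compose[OF assms(1)[unfolded frechet_derivative_works]] assms(2)
  by (simp add: has_field_derivative_def)

lemma pderiv_at_comp:
  assumes "f differentiable at x" "(h has_real_derivative d) (at (f x))"
  shows "pderiv_at i (\<lambda>x. h (f x)) x = d * pderiv_at i f x"
  using has_derivative_pderiv_at[OF has_derivative_real_comp[OF assms]] by (simp add: pderiv_at_def)

lemma smooth_fun_differentiable:
  assumes "smooth_fun f"
  shows "f differentiable at x"
proof -
  have "foldr pderiv_at [] f differentiable_on UNIV"
    using assms unfolding smooth_fun_def by blast
  then show ?thesis
    by (simp add: differentiable_on_def)
qed

lemma smooth_fun_continuous: "smooth_fun f \<Longrightarrow> continuous_on A f"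
  by (meson continuous_at_imp_continuous_on differentiable_imp_continuous_within smooth_fun_differentiable)

lemma smooth_fun_pderiv_at:
  assumes "smooth_fun f"
  shows "smooth_fun (pderiv_at i f)"
  unfolding smooth_fun_def
proof
  fix "is"
  have "foldr pderiv_at (is @ [i]) f differentiable_on UNIV"
    using assms unfolding smooth_fun_def by blast
  then show "foldr pderiv_at is (pderiv_at i f) differentiable_on UNIV"
    by simp
qed

text \<open>Closing a set of functions under partial derivatives up to sums and products suffices for
  smoothness; this spares all iterated Leibniz and chain rules.\<close>

inductive_set fun_algebra :: "('a \<Rightarrow> real) set \<Rightarrow> ('a \<Rightarrow> real) set" for X where
  base: "f \<in> X \<Longrightarrow> f \<in> fun_algebra X"
| add: "f \<in> fun_algebra X \<Longrightarrow> g \<in> fun_algebra X \<Longrightarrow> (\<lambda>x. f x + g x) \<in> fun_algebra X"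
| mult: "f \<in> fun_algebra X \<Longrightarrow> g \<in> fun_algebra X \<Longrightarrow> (\<lambda>x. f x * g x) \<in> fun_algebra X"

lemma fun_algebra_smooth:
  assumes X: "\<And>f x. f \<in> X \<Longrightarrow> f differentiable at x" "\<And>f i. f \<in> X \<Longrightarrow> pderiv_at i f \<in> fun_algebra X"
    and f: "f \<in> fun_algebra X"
  shows "smooth_fun f"
proof -
  have *: "(\<forall>x. f differentiable at x) \<and> (\<forall>i. pderiv_at i f \<in> fun_algebra X)"
    if "f \<in> fun_algebra X" for f
    using that
  proof induction
    case (base f)
    then show ?case using X by blast
  next
    case (add f g)
    then have "pderiv_at i (\<lambda>x. f x + g x) = (\<lambda>x. pderiv_at i f x + pderiv_at i g x)" for i
      by (auto simp: pderiv_at_add)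
    with add show ?case by (auto intro: fun_algebra.intros)
  next
    case (mult f g)
    then have "pderiv_at i (\<lambda>x. f x * g x) = (\<lambda>x. f x * pderiv_at i g x + pderiv_at i f x * g x)" for i
      by (auto simp: pderiv_at_mult)
    with mult show ?case by (auto intro!: fun_algebra.add fun_algebra.mult)
  qed
  have "foldr pderiv_at is f \<in> fun_algebra X" for "is"
    using * f by (induction "is") auto
  with * show ?thesis
    by (auto simp: smooth_fun_def differentiable_on_def)
qed

lemma smooth_fun_const [intro]: "smooth_fun (\<lambda>x. c)"
proof (rule fun_algebra_smooth[where X = "range (\<lambda>c x. c)"])
  fix i and f :: "real^'n \<Rightarrow> real" assume "f \<in> range (\<lambda>c x. c)"
  then have "pderiv_at i f = (\<lambda>x. 0)" by (auto simp: pderiv_at_const)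
  then show "pderiv_at i f \<in> fun_algebra (range (\<lambda>c x. c))" by (auto intro: fun_algebra.base)
qed (auto intro: fun_algebra.base)

lemma smooth_fun_algebra:
  assumes "f \<in> fun_algebra {f. smooth_fun f}"
  shows "smooth_fun f"
  using assms
  by (rule fun_algebra_smooth[rotated -1])
    (auto intro: fun_algebra.base smooth_fun_pderiv_at smooth_fun_differentiable)

lemma smooth_fun_add [intro]: "smooth_fun f \<Longrightarrow> smooth_fun g \<Longrightarrow> smooth_fun (\<lambda>x. f x + g x)"
  by (rule smooth_fun_algebra) (auto intro: fun_algebra.intros)

lemma smooth_fun_mult [intro]: "smooth_fun f \<Longrightarrow> smooth_fun g \<Longrightarrow> smooth_fun (\<lambda>x. f x * g x)"
  by (rule smooth_fun_algebra) (auto intro: fun_algebra.intros)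

lemma smooth_fun_diff [intro]: "smooth_fun f \<Longrightarrow> smooth_fun g \<Longrightarrow> smooth_fun (\<lambda>x. f x - g x)"
  using smooth_fun_add[OF _ smooth_fun_mult[OF smooth_fun_const[of "-1"]], of f g] by simp

lemma smooth_fun_sum:
  "(\<And>j. j \<in> J \<Longrightarrow> smooth_fun (f j)) \<Longrightarrow> smooth_fun (\<lambda>x. \<Sum>j\<in>J. f j x)"
  by (induction J rule: infinite_finite_induct) auto

lemma smooth_fun_nth: "smooth_fun (\<lambda>x::real^'n::finite. x $ i)"
proof (rule fun_algebra_smooth[where X = "insert (\<lambda>x. x $ i) {f. smooth_fun f}"])
  fix j and f :: "real^'n \<Rightarrow> real" assume "f \<in> insert (\<lambda>x. x $ i) {f. smooth_fun f}"
  moreover have "pderiv_at j (\<lambda>x::real^'n. x $ i) = (\<lambda>x. axis j 1 $ i)"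
    by (rule ext, rule has_derivative_pderiv_at)
      (rule bounded_linear_imp_has_derivative[OF bounded_linear_vec_nth])
  ultimately have "smooth_fun (pderiv_at j f)"
    by (auto intro: smooth_fun_pderiv_at)
  then show "pderiv_at j f \<in> fun_algebra (insert (\<lambda>x. x $ i) {f. smooth_fun f})"
    by (auto intro: fun_algebra.base)
next
  fix x and f :: "real^'n \<Rightarrow> real" assume "f \<in> insert (\<lambda>x. x $ i) {f. smooth_fun f}"
  then show "f differentiable at x"
    by (auto intro: smooth_fun_differentiable bounded_linear_imp_differentiable bounded_linear_vec_nth)
qed (auto intro: fun_algebra.base)

lemma smooth_fun_inner: "smooth_fun (\<lambda>x::real^'n::finite. a \<bullet> x)"
  by (auto simp: inner_vec_def intro!: smooth_fun_sum smooth_fun_nth)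

lemma smooth_fun_inner_self: "smooth_fun (\<lambda>x::real^'n::finite. x \<bullet> x)"
  by (auto simp: inner_vec_def intro!: smooth_fun_sum smooth_fun_nth)

text \<open>The family \<open>H\<close> has to be stable under differentiation only at values taken
  by \<open>f\<close>, which admits \<open>ln\<close> for positive \<open>f\<close>. By the chain
  rule, compositions with members of \<open>H\<close> together with the smooth functions generate a
  set closed under partial derivatives.\<close>

lemma smooth_fun_comp:
  assumes f: "smooth_fun f" and "h \<in> H"
    and H: "\<And>h. h \<in> H \<Longrightarrow> \<exists>h'\<in>H. \<forall>x. (h has_real_derivative h' (f x)) (at (f x))"
  shows "smooth_fun (\<lambda>x. h (f x))"
proof (rule fun_algebra_smooth[where X = "(\<lambda>h x. h (f x)) ` H \<union> {f. smooth_fun f}"])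
  fix i g assume "g \<in> (\<lambda>h x. h (f x)) ` H \<union> {f. smooth_fun f}"
  then consider h where "h \<in> H" "g = (\<lambda>x. h (f x))" | "smooth_fun g" by auto
  then show "pderiv_at i g \<in> fun_algebra ((\<lambda>h x. h (f x)) ` H \<union> {f. smooth_fun f})"
  proof cases
    case 1
    with H obtain h' where h': "h' \<in> H" "\<And>x. (h has_real_derivative h' (f x)) (at (f x))" by metis
    then have eq: "pderiv_at i g = (\<lambda>x. h' (f x) * pderiv_at i f x)"
      using f 1 by (auto intro!: pderiv_at_comp smooth_fun_differentiable)
    show ?thesis
      unfolding eq using h'(1) f
      by (intro fun_algebra.mult; intro fun_algebra.base) (auto intro: smooth_fun_pderiv_at)
  qed (auto intro: fun_algebra.base smooth_fun_pderiv_at)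
next
  fix x g assume "g \<in> (\<lambda>h x. h (f x)) ` H \<union> {f. smooth_fun f}"
  then show "g differentiable at x"
    using H has_derivative_real_comp[OF smooth_fun_differentiable[OF f]] smooth_fun_differentiable
    unfolding differentiable_def by (smt (verit) UnE imageE mem_Collect_eq)
qed (use \<open>h \<in> H\<close> in \<open>auto intro: fun_algebra.base\<close>)

lemma smooth_fun_exp: "smooth_fun f \<Longrightarrow> smooth_fun (\<lambda>x. exp (f x))"
  by (rule smooth_fun_comp[where H = "{exp}"]) (auto intro: DERIV_exp)

lemma smooth_fun_ln:
  assumes "smooth_fun f" "\<And>x. f x > 0"
  shows "smooth_fun (\<lambda>x. ln (f x))"
\<comment> \<open>Differentiating \<open>ln\<close> gives \<open>inverse y\<close>, and
  differentiating \<open>c * inverse y ^ n\<close> gives a multiple of the next power, so this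
  family is stable.\<close>
proof (rule smooth_fun_comp[where f = f and h = ln and H = "insert ln (range (\<lambda>(c, n) y. c * inverse y ^ n))"])
  fix h :: "real \<Rightarrow> real" assume "h \<in> insert ln (range (\<lambda>(c, n) y. c * inverse y ^ n))"
  then consider "h = ln" | c n where "h = (\<lambda>y. c * inverse y ^ n)" by auto
  then show "\<exists>h'\<in>insert ln (range (\<lambda>(c, n) y. c * inverse y ^ n)).
      \<forall>x. (h has_real_derivative h' (f x)) (at (f x))"
  proof cases
    case 1
    then show ?thesis using assms(2)
      by (intro bexI[of _ "\<lambda>y. 1 * inverse y ^ 1"])
         (auto intro!: derivative_eq_intros range_eqI[of _ _ "(1,1)"] simp: divide_inverse)
  next
    case 2
    have "(h has_real_derivative (- c * n) * inverse y ^ Suc n) (at y)" if "y > 0" for y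
      unfolding 2 using DERIV_cmult[OF DERIV_power[OF DERIV_inverse], of y c n] that
      by (cases n) (simp_all add: mult_ac del: power_inverse)
    then show ?thesis using assms(2)
      by (intro bexI[of _ "\<lambda>y. (- c * n) * inverse y ^ Suc n"])
         (auto intro!: range_eqI[of _ _ "(- c * real n, Suc n)"])
  qed
qed (use assms in auto)

section \<open>Smooth functions that vanish to infinite order at the origin\<close>

lemma poly_exp_neg_tendsto_0: "((\<lambda>z::real. poly p z * exp (- z)) \<longlongrightarrow> 0) at_top"
proof -
  have "((\<lambda>z::real. \<Sum>i\<le>degree p. coeff p i * (z ^ i / exp z)) \<longlongrightarrow> (\<Sum>i\<le>degree p. coeff p i * 0)) at_top"
    by (intro tendsto_intros tendsto_power_div_exp_0)
  moreover have "(\<Sum>i\<le>degree p. coeff p i * (z ^ i / exp z)) = poly p z * exp (- z)" for z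
    by (simp add: poly_altdef sum_divide_distrib exp_minus field_simps)
  ultimately show ?thesis by simp
qed

text \<open>The polynomial in \<open>inverse y\<close> keeps all derivatives within one family;
  \<open>p = 1\<close> is the classical \<open>exp (- 1 / y)\<close> extended by zero.\<close>

definition flat_fun :: "real poly \<Rightarrow> real \<Rightarrow> real"
  where "flat_fun p y = (if y > 0 then poly p (inverse y) * exp (- inverse y) else 0)"

text \<open>With \<open>z = inverse y\<close>, whose derivative is \<open>- z^2\<close>, the
  derivative of \<open>p(z) exp (- z)\<close> is \<open>z^2 (p(z) - p'(z)) exp (- z)\<close>;
  \<open>[:0, 0, 1:]\<close> is the factor \<open>z^2\<close>.\<close>

lemma flat_fun_has_derivative:
  "(flat_fun p has_real_derivative flat_fun ([:0, 0, 1:] * (p - pderiv p)) y) (at y)"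
proof -
  consider "y > 0" | "y = 0" | "y < 0" by linarith
  then show ?thesis
  proof cases
    case 1
    have "((\<lambda>y. poly p (inverse y) * exp (- inverse y)) has_real_derivative
        poly ([:0, 0, 1:] * (p - pderiv p)) (inverse y) * exp (- inverse y)) (at y)"
      using 1 by (auto intro!: derivative_eq_intros simp: algebra_simps power2_eq_square)
    then show ?thesis
      by (rule DERIV_cong_ev[THEN iffD1, rotated -1])
        (use 1 eventually_nhds_in_open[of "{0<..}" y] in
          \<open>auto simp: flat_fun_def elim!: eventually_mono\<close>)
  next
    case 2
    \<comment> \<open>Dividing by \<open>h\<close> contributes one more power of
      \<open>inverse h\<close>, hence \<open>pCons 0 p\<close>.\<close>
    have "((\<lambda>h. poly (pCons 0 p) (inverse h) * exp (- inverse h)) \<longlongrightarrow> 0) (at_right (0::real))"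
      using filterlim_compose[OF poly_exp_neg_tendsto_0 filterlim_inverse_at_top_right] .
    then have "((\<lambda>h. flat_fun p h / h) \<longlongrightarrow> 0) (at_right (0::real))"
      by (rule Lim_transform_eventually)
        (auto simp: flat_fun_def eventually_at_filter field_simps)
    moreover have "((\<lambda>h. flat_fun p h / h) \<longlongrightarrow> 0) (at_left (0::real))"
      by (rule Lim_transform_eventually[OF tendsto_const])
        (auto simp: flat_fun_def eventually_at_filter)
    ultimately have "((\<lambda>h. flat_fun p h / h) \<longlongrightarrow> 0) (at (0::real))"
      by (simp add: filterlim_split_at)
    with 2 show ?thesis
      by (simp add: DERIV_def) (simp add: flat_fun_def)
  next
    case 3
    have "((\<lambda>y. 0) has_real_derivative 0) (at y)" by simp
    then show ?thesis
      by (rule DERIV_cong_ev[THEN iffD1, rotated -1])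
        (use 3 eventually_nhds_in_open[of "{..<0}" y] in
          \<open>auto simp: flat_fun_def elim!: eventually_mono\<close>)
  qed
qed

lemma smooth_fun_flat_fun: "smooth_fun f \<Longrightarrow> smooth_fun (\<lambda>x. flat_fun p (f x))"
  by (rule smooth_fun_comp[where H = "range flat_fun"]) (auto intro: flat_fun_has_derivative)

section \<open>Test functions\<close>

text \<open>Any compact set outside which the function vanishes will do, so products and derivatives
  can reuse the set \<open>K\<close> of a given test function.\<close>

lemma test_funs_iff:
  "\<phi> \<in> test_funs \<omega> \<longleftrightarrow> smooth_fun \<phi> \<and> (\<exists>K. compact K \<and> K \<subseteq> \<omega> \<and> (\<forall>x. x \<notin> K \<longrightarrow> \<phi> x = 0))"
proof
  assume "\<phi> \<in> test_funs \<omega>"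
  moreover have "support_on UNIV \<phi> \<subseteq> closure (support_on UNIV \<phi>)"
    by (rule closure_subset)
  ultimately show "smooth_fun \<phi> \<and> (\<exists>K. compact K \<and> K \<subseteq> \<omega> \<and> (\<forall>x. x \<notin> K \<longrightarrow> \<phi> x = 0))"
    unfolding test_funs_def support_on_def by blast
next
  assume "smooth_fun \<phi> \<and> (\<exists>K. compact K \<and> K \<subseteq> \<omega> \<and> (\<forall>x. x \<notin> K \<longrightarrow> \<phi> x = 0))"
  then obtain K where K: "smooth_fun \<phi>" "compact K" "K \<subseteq> \<omega>" "\<And>x. x \<notin> K \<Longrightarrow> \<phi> x = 0"
    by blast
  then have "support_on UNIV \<phi> \<subseteq> K" by (auto simp: support_on_def)
  with K have "closure (support_on UNIV \<phi>) \<subseteq> K"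
    by (simp add: closure_minimal compact_imp_closed)
  with K show "\<phi> \<in> test_funs \<omega>"
    unfolding test_funs_def by (simp add: compact_eq_bounded_closed) (meson bounded_subset order_trans)
qed

lemma test_funs_smooth: "\<phi> \<in> test_funs \<omega> \<Longrightarrow> smooth_fun \<phi>"
  by (simp add: test_funs_def)

lemma test_funs_mult:
  "smooth_fun f \<Longrightarrow> \<phi> \<in> test_funs \<omega> \<Longrightarrow> (\<lambda>x. f x * \<phi> x) \<in> test_funs \<omega>"
  unfolding test_funs_iff by (auto intro: smooth_fun_mult)

lemma test_funs_pderiv_at:
  assumes "\<phi> \<in> test_funs \<omega>"
  shows "pderiv_at i \<phi> \<in> test_funs \<omega>"
proof -
  obtain K where K: "smooth_fun \<phi>" "compact K" "K \<subseteq> \<omega>" "\<And>x. x \<notin> K \<Longrightarrow> \<phi> x = 0"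
    using assms unfolding test_funs_iff by blast
  have "pderiv_at i \<phi> x = 0" if "x \<notin> K" for x
  proof -
    have "(\<phi> has_derivative (\<lambda>_. 0)) (at x)"
      by (rule has_derivative_transform_within_open[where s = "- K", OF has_derivative_const])
        (use K that in \<open>auto simp: compact_imp_closed open_Compl\<close>)
    then show ?thesis by (rule has_derivative_pderiv_at)
  qed
  with K show ?thesis
    unfolding test_funs_iff using smooth_fun_pderiv_at by blast
qed

section \<open>Symmetry of second partial derivatives\<close>

lemma has_real_derivative_pderiv_at_line:
  assumes "f differentiable at (x + t *\<^sub>R axis i 1)"
  shows "((\<lambda>t. f (x + t *\<^sub>R axis i 1)) has_real_derivative pderiv_at i f (x + t *\<^sub>R axis i 1)) (at t)"
proof -
  let ?D = "frechet_derivative f (at (x + t *\<^sub>R axis i 1))"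
  have "((\<lambda>t. x + t *\<^sub>R axis i 1) has_derivative (\<lambda>s. s *\<^sub>R axis i 1)) (at t)"
    by (auto intro!: derivative_eq_intros)
  from has_derivative_compose[OF this assms[unfolded frechet_derivative_works]]
  have "((\<lambda>t. f (x + t *\<^sub>R axis i 1)) has_derivative (\<lambda>s. ?D (s *\<^sub>R axis i 1))) (at t)" .
  moreover have "?D (s *\<^sub>R axis i 1) = pderiv_at i f (x + t *\<^sub>R axis i 1) * s" for s
    using linear_cmul[OF linear_frechet_derivative[OF assms]] by (simp add: pderiv_at_def)
  ultimately show ?thesis
    by (simp add: has_field_derivative_def)
qed

text \<open>The mean value theorem is applied in direction \<open>i\<close> to a difference in
  direction \<open>j\<close>, then in direction \<open>j\<close> to the partial derivative. The left
  side is symmetric in \<open>i\<close> and \<open>j\<close>, so it serves both orders of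
  differentiation.\<close>

lemma second_difference_pderiv_at:
  assumes f: "smooth_fun f" and s: "s > 0"
  obtains t t' where "t \<in> {0..s}" "t' \<in> {0..s}"
    "f (x + s *\<^sub>R axis i 1 + s *\<^sub>R axis j 1) - f (x + s *\<^sub>R axis i 1) - f (x + s *\<^sub>R axis j 1) + f x
      = s\<^sup>2 * pderiv_at j (pderiv_at i f) (x + t *\<^sub>R axis i 1 + t' *\<^sub>R axis j 1)"
proof -
  note D = has_real_derivative_pderiv_at_line[OF smooth_fun_differentiable]
  define g where "g = (\<lambda>t. f (x + s *\<^sub>R axis j 1 + t *\<^sub>R axis i 1) - f (x + t *\<^sub>R axis i 1))"
  have "(g has_real_derivative
      pderiv_at i f (x + s *\<^sub>R axis j 1 + t *\<^sub>R axis i 1) - pderiv_at i f (x + t *\<^sub>R axis i 1)) (at t)" for t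
    unfolding g_def by (intro DERIV_diff D f)
  from MVT2[OF s this] obtain t where t: "0 < t" "t < s" "g s - g 0 = s *
      (pderiv_at i f (x + s *\<^sub>R axis j 1 + t *\<^sub>R axis i 1) - pderiv_at i f (x + t *\<^sub>R axis i 1))"
    by auto
  define h where "h = (\<lambda>r. pderiv_at i f (x + t *\<^sub>R axis i 1 + r *\<^sub>R axis j 1))"
  have "(h has_real_derivative pderiv_at j (pderiv_at i f) (x + t *\<^sub>R axis i 1 + r *\<^sub>R axis j 1)) (at r)" for r
    unfolding h_def by (intro D f smooth_fun_pderiv_at)
  from MVT2[OF s this] obtain t' where t': "0 < t'" "t' < s"
    "h s - h 0 = s * pderiv_at j (pderiv_at i f) (x + t *\<^sub>R axis i 1 + t' *\<^sub>R axis j 1)"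
    by auto
  have "g s - g 0 = s * (h s - h 0)"
    using t(3) by (simp add: h_def add_ac)
  then have "g s - g 0 = s\<^sup>2 * pderiv_at j (pderiv_at i f) (x + t *\<^sub>R axis i 1 + t' *\<^sub>R axis j 1)"
    using t'(3) by (simp add: power2_eq_square)
  with t t' show ?thesis
    by (intro that[of t t']) (auto simp: g_def add_ac)
qed

text \<open>The same second difference equals \<open>s^2\<close> times either mixed derivative, each
  taken at a point within \<open>2 * s\<close> of \<open>x\<close>; by continuity the two cannot
  differ at \<open>x\<close>.\<close>

lemma pderiv_at_commute:
  fixes f :: "real^'n::finite \<Rightarrow> real"
  assumes f: "smooth_fun f"
  shows "pderiv_at i (pderiv_at j f) x = pderiv_at j (pderiv_at i f) x"
proof (rule ccontr)
  let ?A = "pderiv_at i (pderiv_at j f)" and ?B = "pderiv_at j (pderiv_at i f)"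
  assume "?A x \<noteq> ?B x"
  define e where "e = dist (?A x) (?B x) / 2"
  then have e: "e > 0"
    using \<open>?A x \<noteq> ?B x\<close> zero_less_dist_iff[of "?A x" "?B x"] by linarith
  have "continuous_on UNIV ?A" "continuous_on UNIV ?B"
    by (auto intro!: smooth_fun_continuous smooth_fun_pderiv_at f)
  then have "\<exists>d1>0. \<forall>y. dist y x < d1 \<longrightarrow> dist (?A y) (?A x) < e"
    "\<exists>d2>0. \<forall>y. dist y x < d2 \<longrightarrow> dist (?B y) (?B x) < e"
    using e unfolding continuous_on_iff by auto
  then obtain d1 d2 where d: "d1 > 0" "d2 > 0"
      "\<And>y. dist y x < d1 \<Longrightarrow> dist (?A y) (?A x) < e"
      "\<And>y. dist y x < d2 \<Longrightarrow> dist (?B y) (?B x) < e"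
    by blast
  define s where "s = min d1 d2 / 3"
  have s: "s > 0" "2 * s < d1" "2 * s < d2" using d by (auto simp: s_def)
  have dist: "dist (x + t *\<^sub>R axis k 1 + t' *\<^sub>R axis l 1) x \<le> 2 * s"
    if "t \<in> {0..s}" "t' \<in> {0..s}" for t t' and k l :: 'n
  proof -
    have "norm (t *\<^sub>R axis k (1::real) + t' *\<^sub>R axis l 1) \<le> norm (t *\<^sub>R axis k (1::real)) + norm (t' *\<^sub>R axis l (1::real))"
      by (rule norm_triangle_ineq)
    also have "\<dots> \<le> 2 * s" using that by simp
    finally show ?thesis by (simp add: dist_norm add.assoc)
  qed
  obtain t t' where t: "t \<in> {0..s}" "t' \<in> {0..s}"
    "f (x + s *\<^sub>R axis i 1 + s *\<^sub>R axis j 1) - f (x + s *\<^sub>R axis i 1) - f (x + s *\<^sub>R axis j 1) + f x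
      = s\<^sup>2 * ?B (x + t *\<^sub>R axis i 1 + t' *\<^sub>R axis j 1)"
    using second_difference_pderiv_at[OF f s(1)] by blast
  obtain r r' where r: "r \<in> {0..s}" "r' \<in> {0..s}"
    "f (x + s *\<^sub>R axis j 1 + s *\<^sub>R axis i 1) - f (x + s *\<^sub>R axis j 1) - f (x + s *\<^sub>R axis i 1) + f x
      = s\<^sup>2 * ?A (x + r *\<^sub>R axis j 1 + r' *\<^sub>R axis i 1)"
    using second_difference_pderiv_at[OF f s(1)] by blast
  have comm: "x + s *\<^sub>R axis j 1 + s *\<^sub>R axis i 1 = x + s *\<^sub>R axis i 1 + s *\<^sub>R axis j 1"
    by (simp add: add_ac)
  have "s\<^sup>2 * ?B (x + t *\<^sub>R axis i 1 + t' *\<^sub>R axis j 1) = s\<^sup>2 * ?A (x + r *\<^sub>R axis j 1 + r' *\<^sub>R axis i 1)"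
    using t(3) r(3) unfolding comm by linarith
  then have "?B (x + t *\<^sub>R axis i 1 + t' *\<^sub>R axis j 1) = ?A (x + r *\<^sub>R axis j 1 + r' *\<^sub>R axis i 1)"
    using s(1) by simp
  moreover have "dist (?A (x + r *\<^sub>R axis j 1 + r' *\<^sub>R axis i 1)) (?A x) < e"
    using d(3) dist[OF r(1,2)] s(2) by (meson le_less_trans)
  moreover have "dist (?B (x + t *\<^sub>R axis i 1 + t' *\<^sub>R axis j 1)) (?B x) < e"
    using d(4) dist[OF t(1,2)] s(3) by (meson le_less_trans)
  ultimately show False
    using dist_triangle[of "?A x" "?B x" "?B (x + t *\<^sub>R axis i 1 + t' *\<^sub>R axis j 1)"]
    by (simp add: e_def dist_commute)
qed

section \<open>Square integrable functions and weak derivatives\<close>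

lemma L2_mult_integrable:
  assumes "f \<in> L2 \<omega>" "g \<in> L2 \<omega>"
  shows "integrable (lebesgue_on \<omega>) (\<lambda>x. f x * g x)"
proof (rule Bochner_Integration.integrable_bound)
  show "integrable (lebesgue_on \<omega>) (\<lambda>x. (f x)\<^sup>2 + (g x)\<^sup>2)"
    using assms by (simp add: L2_def)
  have "\<bar>a * b\<bar> \<le> a\<^sup>2 + b\<^sup>2" for a b :: real
    using sum_squares_bound[of a b] sum_squares_bound[of a "- b"] by (auto simp: abs_if)
  then show "AE x in lebesgue_on \<omega>. norm (f x * g x) \<le> norm ((f x)\<^sup>2 + (g x)\<^sup>2)"
    by simp
qed (use assms in \<open>auto simp: L2_def\<close>)

lemma L2_add:
  assumes "f \<in> L2 \<omega>" "g \<in> L2 \<omega>"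
  shows "(\<lambda>x. f x + g x) \<in> L2 \<omega>"
  using L2_mult_integrable[OF assms] assms by (auto simp: L2_def power2_sum mult.assoc)

lemma L2_mult_bounded:
  assumes f: "f \<in> L2 \<omega>" and g: "g \<in> borel_measurable (lebesgue_on \<omega>)"
    and C: "\<And>x. x \<in> \<omega> \<Longrightarrow> \<bar>g x\<bar> \<le> C"
  shows "(\<lambda>x. g x * f x) \<in> L2 \<omega>"
proof -
  have "integrable (lebesgue_on \<omega>) (\<lambda>x. (g x * f x)\<^sup>2)"
  proof (rule Bochner_Integration.integrable_bound)
    show "integrable (lebesgue_on \<omega>) (\<lambda>x. C\<^sup>2 * (f x)\<^sup>2)"
      using f by (simp add: L2_def)
    have "(g x * f x)\<^sup>2 \<le> C\<^sup>2 * (f x)\<^sup>2" if "x \<in> \<omega>" for x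
      using power_mono[OF C[OF that], of 2]
      by (simp add: power_mult_distrib mult_right_mono)
    then show "AE x in lebesgue_on \<omega>. norm ((g x * f x)\<^sup>2) \<le> norm (C\<^sup>2 * (f x)\<^sup>2)"
      by (intro AE_I2) simp
  qed (use f g in \<open>auto simp: L2_def\<close>)
  with f g show ?thesis by (auto simp: L2_def)
qed

lemma L2_cmult: "f \<in> L2 \<omega> \<Longrightarrow> (\<lambda>x. c * f x) \<in> L2 \<omega>"
  by (rule L2_mult_bounded[where C = "\<bar>c\<bar>"]) auto

lemma L2_diff: "f \<in> L2 \<omega> \<Longrightarrow> g \<in> L2 \<omega> \<Longrightarrow> (\<lambda>x. f x - g x) \<in> L2 \<omega>"
  using L2_add[OF _ L2_cmult[where c = "-1"], of f \<omega> g] by simp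

lemma smooth_fun_bounded:
  assumes "smooth_fun f" "bounded \<omega>"
  obtains C where "\<And>x. x \<in> \<omega> \<Longrightarrow> \<bar>f x\<bar> \<le> C"
proof -
  have "bounded (f ` closure \<omega>)"
    using assms by (intro compact_imp_bounded compact_continuous_image smooth_fun_continuous)
      (auto simp: compact_closure)
  then obtain C where "\<And>y. y \<in> f ` closure \<omega> \<Longrightarrow> norm y \<le> C"
    using bounded_iff by metis
  then show thesis
    using closure_subset[of \<omega>] by (intro that[of C]) auto
qed

lemma smooth_fun_measurable:
  assumes "smooth_fun f" "\<omega> \<in> sets lebesgue"
  shows "f \<in> borel_measurable (lebesgue_on \<omega>)"
  using assms by (intro continuous_imp_measurable_on_sets_lebesgue smooth_fun_continuous)

lemma L2_mult_smooth:
  assumes "smooth_fun g" "f \<in> L2 \<omega>" "bounded \<omega>" "\<omega> \<in> sets lebesgue"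
  shows "(\<lambda>x. g x * f x) \<in> L2 \<omega>"
  using smooth_fun_bounded[OF assms(1,3)] L2_mult_bounded[OF assms(2) smooth_fun_measurable[OF assms(1,4)]]
  by metis

lemma smooth_fun_L2:
  assumes "smooth_fun g" "bounded \<omega>" "\<omega> \<in> sets lebesgue"
  shows "g \<in> L2 \<omega>"
proof -
  have "(\<lambda>x. 1) \<in> L2 \<omega>"
    using finite_measure.integrable_const[OF finite_measure_lebesgue_on[OF bounded_set_imp_lmeasurable[OF assms(2,3)]], of "1::real"]
    by (simp add: L2_def)
  from L2_mult_smooth[OF assms(1) this assms(2,3)] show ?thesis by simp
qed

lemma L2_Cauchy_Schwarz:
  assumes f: "f \<in> L2 \<omega>" and g: "g \<in> L2 \<omega>"
  shows "\<bar>integral\<^sup>L (lebesgue_on \<omega>) (\<lambda>x. f x * g x)\<bar> \<le> L2_norm \<omega> f * L2_norm \<omega> g"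
proof -
  let ?I = "integral\<^sup>L (lebesgue_on \<omega>)"
  define A B D where "A = ?I (\<lambda>x. (f x)\<^sup>2)" and "B = ?I (\<lambda>x. f x * g x)" and "D = ?I (\<lambda>x. (g x)\<^sup>2)"
  \<comment> \<open>The integral of \<open>(f - t g)^2\<close> is a nonnegative quadratic in
    \<open>t\<close>. It is evaluated at its minimiser \<open>B / D\<close>, or, if
    \<open>D = 0\<close>, at a point that would give \<open>A + 1 \<le> A\<close> for nonzero
    \<open>B\<close>.\<close>
  have "0 \<le> A - 2 * t * B + t\<^sup>2 * D" for t
  proof -
    have "0 \<le> ?I (\<lambda>x. (f x - t * g x)\<^sup>2)" by simp
    also have "(\<lambda>x. (f x - t * g x)\<^sup>2) = (\<lambda>x. (f x)\<^sup>2 - 2 * t * (f x * g x) + t\<^sup>2 * (g x)\<^sup>2)"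
      by (auto simp: power2_eq_square algebra_simps)
    also have "?I \<dots> = A - 2 * t * B + t\<^sup>2 * D"
      using f g L2_mult_integrable[OF f g] by (simp add: A_def B_def D_def L2_def)
    finally show ?thesis .
  qed
  note quad = this
  have "B\<^sup>2 \<le> A * D"
  proof (cases "D = 0")
    case True
    then have "2 * t * B \<le> A" for t using quad[of t] by simp
    from this[of "(A + 1) / (2 * B)"] have "B = 0" by (auto split: if_splits)
    with True show ?thesis by simp
  next
    case False
    moreover have "0 \<le> D" by (simp add: D_def)
    ultimately have "D > 0" by simp
    with quad[of "B / D"] show ?thesis
      by (simp add: power2_eq_square field_simps)
  qed
  then have "sqrt (B\<^sup>2) \<le> sqrt (A * D)" by (rule real_sqrt_le_mono)
  then show ?thesis
    by (simp add: A_def B_def D_def L2_norm_def real_sqrt_mult)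
qed

lemma L2_tendsto_integral_mult:
  assumes lim: "(\<lambda>n. L2_norm \<omega> (\<lambda>x. f x - \<phi> n x)) \<longlonglongrightarrow> 0"
    and L2: "f \<in> L2 \<omega>" "\<And>n. \<phi> n \<in> L2 \<omega>" "g \<in> L2 \<omega>"
  shows "(\<lambda>n. integral\<^sup>L (lebesgue_on \<omega>) (\<lambda>x. g x * \<phi> n x))
    \<longlonglongrightarrow> integral\<^sup>L (lebesgue_on \<omega>) (\<lambda>x. g x * f x)"
proof (rule LIM_zero_cancel, rule tendsto_rabs_zero_cancel, rule tendsto_sandwich[OF _ _ tendsto_const])
  have "integral\<^sup>L (lebesgue_on \<omega>) (\<lambda>x. g x * \<phi> n x) - integral\<^sup>L (lebesgue_on \<omega>) (\<lambda>x. g x * f x)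
      = - integral\<^sup>L (lebesgue_on \<omega>) (\<lambda>x. g x * (f x - \<phi> n x))" for n
    using L2_mult_integrable[OF L2(3) L2(2)] L2_mult_integrable[OF L2(3) L2(1)]
    by (simp add: right_diff_distrib)
  then show "\<forall>\<^sub>F n in sequentially. \<bar>integral\<^sup>L (lebesgue_on \<omega>) (\<lambda>x. g x * \<phi> n x)
      - integral\<^sup>L (lebesgue_on \<omega>) (\<lambda>x. g x * f x)\<bar> \<le> L2_norm \<omega> g * L2_norm \<omega> (\<lambda>x. f x - \<phi> n x)"
    using L2_Cauchy_Schwarz[OF L2(3) L2_diff[OF L2(1,2)]] by simp
  show "(\<lambda>n. L2_norm \<omega> g * L2_norm \<omega> (\<lambda>x. f x - \<phi> n x)) \<longlonglongrightarrow> 0"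
    using tendsto_mult_left[OF lim, of "L2_norm \<omega> g"] by simp
qed simp

text \<open>The product of \<open>f\<close> with a test function is again a test function, so the
  weak derivative may be tested against it, whatever \<open>f\<close> does near the
  boundary.\<close>

lemma weak_partial_product_rule:
  assumes weak: "has_L2_weak_partial \<omega> i u g"
    and f: "smooth_fun f" and \<phi>: "\<phi> \<in> test_funs \<omega>"
    and \<omega>: "bounded \<omega>" "\<omega> \<in> sets lebesgue"
  shows "integral\<^sup>L (lebesgue_on \<omega>) (\<lambda>x. pderiv_at i f x * u x * \<phi> x) =
    - integral\<^sup>L (lebesgue_on \<omega>) (\<lambda>x. f x * g x * \<phi> x)
    - integral\<^sup>L (lebesgue_on \<omega>) (\<lambda>x. f x * u x * pderiv_at i \<phi> x)"
proof -
  let ?I = "integral\<^sup>L (lebesgue_on \<omega>)"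
  have u: "u \<in> L2 \<omega>" using weak by (simp add: has_L2_weak_partial_def)
  note sm = f \<phi>[THEN test_funs_smooth] \<phi>[THEN test_funs_pderiv_at, THEN test_funs_smooth]
    smooth_fun_pderiv_at[OF f]
  have int: "integrable (lebesgue_on \<omega>) (\<lambda>x. pderiv_at i f x * u x * \<phi> x)"
    "integrable (lebesgue_on \<omega>) (\<lambda>x. f x * u x * pderiv_at i \<phi> x)"
    by (intro L2_mult_integrable L2_mult_smooth smooth_fun_L2 sm \<omega> u)+
  have "?I (\<lambda>x. u x * pderiv_at i (\<lambda>x. f x * \<phi> x) x) = - ?I (\<lambda>x. g x * (f x * \<phi> x))"
    using weak test_funs_mult[OF f \<phi>] unfolding has_L2_weak_partial_def by blast
  also have "(\<lambda>x. u x * pderiv_at i (\<lambda>x. f x * \<phi> x) x)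
      = (\<lambda>x. f x * u x * pderiv_at i \<phi> x + pderiv_at i f x * u x * \<phi> x)"
    using sm by (auto simp: pderiv_at_mult smooth_fun_differentiable algebra_simps)
  also have "?I \<dots> = ?I (\<lambda>x. f x * u x * pderiv_at i \<phi> x) + ?I (\<lambda>x. pderiv_at i f x * u x * \<phi> x)"
    using int by simp
  finally show ?thesis by (simp add: mult_ac)
qed

section \<open>Functions that vanish on the boundary\<close>

lemma H1_L2: "u \<in> H1 \<omega> \<Longrightarrow> u \<in> L2 \<omega>"
  by (simp add: H1_def)

lemma weak_partial_L2: "u \<in> H1 \<omega> \<Longrightarrow> weak_partial \<omega> i u \<in> L2 \<omega>"
  using has_L2_weak_partial_weak_partial unfolding has_L2_weak_partial_def by blast

text \<open>Norm convergence enters only through pairings with a fixed square integrable function,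
  which Cauchy-Schwarz controls.\<close>

lemma H10_approx:
  assumes "u \<in> H10 \<omega>" "bounded \<omega>" "\<omega> \<in> sets lebesgue"
  obtains \<phi> where "\<And>n. \<phi> n \<in> test_funs \<omega>"
    "\<And>g. g \<in> L2 \<omega> \<Longrightarrow> (\<lambda>n. integral\<^sup>L (lebesgue_on \<omega>) (\<lambda>x. g x * \<phi> n x))
      \<longlonglongrightarrow> integral\<^sup>L (lebesgue_on \<omega>) (\<lambda>x. g x * u x)"
    "\<And>g i. g \<in> L2 \<omega> \<Longrightarrow> (\<lambda>n. integral\<^sup>L (lebesgue_on \<omega>) (\<lambda>x. g x * pderiv_at i (\<phi> n) x))
      \<longlonglongrightarrow> integral\<^sup>L (lebesgue_on \<omega>) (\<lambda>x. g x * weak_partial \<omega> i u x)"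
proof -
  from assms(1) obtain \<phi> where u: "u \<in> H1 \<omega>" and \<phi>: "\<And>n. \<phi> n \<in> test_funs \<omega>"
    and lim: "(\<lambda>n. L2_norm \<omega> (\<lambda>x. u x - \<phi> n x)) \<longlonglongrightarrow> 0"
      "\<And>i. (\<lambda>n. L2_norm \<omega> (\<lambda>x. weak_partial \<omega> i u x - pderiv_at i (\<phi> n) x)) \<longlonglongrightarrow> 0"
    unfolding H10_def by auto
  have L2: "\<phi> n \<in> L2 \<omega>" "pderiv_at i (\<phi> n) \<in> L2 \<omega>" for n i
    using \<phi>[of n, THEN test_funs_smooth] assms by (auto intro!: smooth_fun_L2 smooth_fun_pderiv_at)
  show thesis
    using L2_tendsto_integral_mult[OF lim(1) H1_L2[OF u] L2(1)]
      L2_tendsto_integral_mult[OF lim(2) weak_partial_L2[OF u] L2(2)]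
    by (intro that[of \<phi>, OF \<phi>]) auto
qed

lemma zero_in_if_integral_square_zero:
  assumes "f \<in> L2 \<omega>" "integral\<^sup>L (lebesgue_on \<omega>) (\<lambda>x. f x * f x) = 0"
  shows "zero_in \<omega> f"
  using integral_nonneg_eq_0_iff_AE[OF L2_mult_integrable[OF assms(1,1)]] assms(2)
  by (simp add: zero_in_def)

lemma integral_mult_zero_in:
  fixes f g h :: "real^'n::finite \<Rightarrow> real"
  assumes "zero_in \<omega> f"
  shows "integral\<^sup>L (lebesgue_on \<omega>) (\<lambda>x. g x * f x * h x) = 0"
proof -
  have "AE x in lebesgue_on \<omega>. g x * f x * h x = 0"
    using assms unfolding zero_in_def by (rule eventually_mono) simp
  then show ?thesis by (rule integral_eq_zero_AE)
qed

text \<open>Poincare's argument: a coordinate has partial derivative \<open>1\<close> in its own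
  direction, so integrating by parts against it turns the integral of \<open>u^2\<close> into
  integrals containing a partial derivative of \<open>u\<close>.\<close>

lemma H10_zero_if_gradient_zero:
  fixes u :: "real^'n::finite \<Rightarrow> real"
  assumes u: "u \<in> H10 \<omega>" and \<omega>: "bounded \<omega>" "\<omega> \<in> sets lebesgue"
    and zero: "\<And>i. zero_in \<omega> (weak_partial \<omega> i u)"
  shows "zero_in \<omega> u"
proof -
  let ?I = "integral\<^sup>L (lebesgue_on \<omega>)"
  fix i :: 'n
  let ?X = "\<lambda>x::real^'n. x $ i"
  have uH: "u \<in> H1 \<omega>" using u by (simp add: H10_def)
  obtain \<phi> where \<phi>: "\<And>n. \<phi> n \<in> test_funs \<omega>"
    "\<And>g. g \<in> L2 \<omega> \<Longrightarrow> (\<lambda>n. ?I (\<lambda>x. g x * \<phi> n x)) \<longlonglongrightarrow> ?I (\<lambda>x. g x * u x)"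
    "\<And>g i. g \<in> L2 \<omega> \<Longrightarrow> (\<lambda>n. ?I (\<lambda>x. g x * pderiv_at i (\<phi> n) x)) \<longlonglongrightarrow> ?I (\<lambda>x. g x * weak_partial \<omega> i u x)"
    using H10_approx[OF u \<omega>] by blast
  have X: "pderiv_at i ?X x = 1" for x
    by (rule has_derivative_pderiv_at[OF bounded_linear_imp_has_derivative[OF bounded_linear_vec_nth], THEN trans]) simp
  have XL: "(\<lambda>x. x $ i * u x) \<in> L2 \<omega>"
    by (intro L2_mult_smooth smooth_fun_nth H1_L2 uH \<omega>)
  \<comment> \<open>One term of the product rule contains \<open>weak_partial \<omega> i u\<close>
    and vanishes for every \<open>n\<close>; the other acquires this factor in the limit.\<close>
  have "?I (\<lambda>x. u x * \<phi> n x) = - ?I (\<lambda>x. x $ i * u x * pderiv_at i (\<phi> n) x)" for n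
    using weak_partial_product_rule[OF has_L2_weak_partial_weak_partial[OF uH] smooth_fun_nth \<phi>(1) \<omega>, of i i n]
      integral_mult_zero_in[OF zero[of i], of ?X "\<phi> n"]
    by (simp add: X)
  then have "?I (\<lambda>x. u x * u x) = - ?I (\<lambda>x. x $ i * u x * weak_partial \<omega> i u x)"
    using LIMSEQ_unique[OF \<phi>(2)[OF H1_L2[OF uH]]] tendsto_minus[OF \<phi>(3)[OF XL, of i]] by simp
  also have "\<dots> = 0"
    using integral_mult_zero_in[OF zero[of i], of "\<lambda>x. x $ i * u x" "\<lambda>_. 1"] by simp
  finally show ?thesis
    using zero_in_if_integral_square_zero[OF H1_L2[OF uH]] by blast
qed

text \<open>Testing the pure second derivatives with approximations of \<open>u\<close> shows in the
  limit that each first derivative has a square with integral zero.\<close>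

lemma H10_zero_if_hessian_zero:
  assumes u: "u \<in> H10 \<omega>" "u \<in> H2 \<omega>" and \<omega>: "bounded \<omega>" "\<omega> \<in> sets lebesgue"
    and zero: "\<And>i. zero_in \<omega> (weak_partial \<omega> i (weak_partial \<omega> i u))"
  shows "zero_in \<omega> u"
proof (rule H10_zero_if_gradient_zero[OF u(1) \<omega>], rule zero_in_if_integral_square_zero)
  fix i
  let ?I = "integral\<^sup>L (lebesgue_on \<omega>)" and ?p = "weak_partial \<omega> i u"
  have p: "?p \<in> H1 \<omega>" using u by (simp add: H2_def)
  then show "?p \<in> L2 \<omega>" by (rule H1_L2)
  obtain \<phi> where \<phi>: "\<And>n. \<phi> n \<in> test_funs \<omega>"
    "\<And>g. g \<in> L2 \<omega> \<Longrightarrow> (\<lambda>n. ?I (\<lambda>x. g x * \<phi> n x)) \<longlonglongrightarrow> ?I (\<lambda>x. g x * u x)"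
    "\<And>g i. g \<in> L2 \<omega> \<Longrightarrow> (\<lambda>n. ?I (\<lambda>x. g x * pderiv_at i (\<phi> n) x)) \<longlonglongrightarrow> ?I (\<lambda>x. g x * weak_partial \<omega> i u x)"
    using H10_approx[OF u(1) \<omega>] by blast
  have "?I (\<lambda>x. ?p x * pderiv_at i (\<phi> n) x) = 0" for n
    using has_L2_weak_partial_weak_partial[OF p, of i] \<phi>(1)[of n] integral_mult_zero_in[OF zero[of i], of "\<lambda>_. 1" "\<phi> n"]
    unfolding has_L2_weak_partial_def by simp
  then show "?I (\<lambda>x. ?p x * ?p x) = 0"
    using \<phi>(3)[OF H1_L2[OF p], of i] by (simp add: LIMSEQ_const_iff)
qed

section \<open>The very weak Hessian determinant\<close>

text \<open>\<open>cof_form \<psi> p\<close> is \<open>cof (D\<^sup>2 \<psi>) p \<cdot> p\<close>, and \<open>cof_flux \<omega> p\<close> is \<open>cof (Dp) p\<close>.\<close>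

definition cof_form :: "(real^2 \<Rightarrow> real) \<Rightarrow> (2 \<Rightarrow> real^2 \<Rightarrow> real) \<Rightarrow> real^2 \<Rightarrow> real"
  where "cof_form \<psi> p x = pderiv_at 2 (pderiv_at 2 \<psi>) x * (p 1 x)\<^sup>2
    + pderiv_at 1 (pderiv_at 1 \<psi>) x * (p 2 x)\<^sup>2
    - 2 * pderiv_at 1 (pderiv_at 2 \<psi>) x * p 1 x * p 2 x"

definition cof_flux :: "(real^2) set \<Rightarrow> (2 \<Rightarrow> real^2 \<Rightarrow> real) \<Rightarrow> 2 \<Rightarrow> real^2 \<Rightarrow> real"
  where "cof_flux \<omega> p i x =
    (if i = 1 then weak_partial \<omega> 2 (p 2) x * p 1 x - weak_partial \<omega> 1 (p 2) x * p 2 x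
     else weak_partial \<omega> 1 (p 1) x * p 2 x - weak_partial \<omega> 2 (p 1) x * p 1 x)"

lemma pderiv_at_commute_fun:
  "smooth_fun f \<Longrightarrow> pderiv_at i (pderiv_at j f) = pderiv_at j (pderiv_at i f)"
  by (rule ext) (rule pderiv_at_commute)

lemma weak_partial_test:
  assumes "u \<in> H1 \<omega>" "\<phi> \<in> test_funs \<omega>"
  shows "integral\<^sup>L (lebesgue_on \<omega>) (\<lambda>x. \<phi> x * weak_partial \<omega> i u x)
    = - integral\<^sup>L (lebesgue_on \<omega>) (\<lambda>x. u x * pderiv_at i \<phi> x)"
  using has_L2_weak_partial_weak_partial[OF assms(1), of i] assms(2)
  by (simp add: has_L2_weak_partial_def mult.commute)

lemma cof_form_integrable:
  assumes \<omega>: "bounded \<omega>" "\<omega> \<in> sets lebesgue"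
    and p: "\<And>a. p a \<in> L2 \<omega>" and \<psi>: "smooth_fun \<psi>"
  shows "integrable (lebesgue_on \<omega>) (cof_form \<psi> p)"
proof -
  have "integrable (lebesgue_on \<omega>) (\<lambda>x. pderiv_at a (pderiv_at b \<psi>) x * p c x * p d x)" for a b c d
    by (intro L2_mult_integrable L2_mult_smooth p \<omega> smooth_fun_pderiv_at \<psi>)
  then have "integrable (lebesgue_on \<omega>) (\<lambda>x. pderiv_at 2 (pderiv_at 2 \<psi>) x * p 1 x * p 1 x
    + pderiv_at 1 (pderiv_at 1 \<psi>) x * p 2 x * p 2 x - 2 * (pderiv_at 1 (pderiv_at 2 \<psi>) x * p 1 x * p 2 x))"
    by (intro Bochner_Integration.integrable_add Bochner_Integration.integrable_diff integrable_mult_right)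
  then show ?thesis
    by (rule back_subst[of "integrable _"]) (auto simp: cof_form_def power2_eq_square mult_ac)
qed

text \<open>The compatibility condition of Saint-Venant, tested against \<open>\<phi>\<close>, eliminates the in-plane
  displacement and leaves the very weak form of \<open>det (D\<^sup>2 w) = 0\<close>.\<close>

lemma integral_cof_form_test_fun:
  assumes \<omega>: "bounded \<omega>" "\<omega> \<in> sets lebesgue"
    and u: "\<And>\<alpha>. u \<alpha> \<in> H1 \<omega>" and w: "w \<in> H1 \<omega>" and strain: "zero_in \<omega> (strain \<omega> (u, w))"
    and \<phi>: "\<phi> \<in> test_funs \<omega>"
  shows "integral\<^sup>L (lebesgue_on \<omega>) (cof_form \<phi> (\<lambda>a. weak_partial \<omega> a w)) = 0"
proof -
  let ?I = "integral\<^sup>L (lebesgue_on \<omega>)"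
  let ?D = "\<lambda>a b. weak_partial \<omega> a (u b)" and ?p = "\<lambda>a. weak_partial \<omega> a w"
  let ?f = "\<lambda>a b. pderiv_at a (pderiv_at b \<phi>)"
  have tf: "?f a b \<in> test_funs \<omega>" for a b
    by (intro test_funs_pderiv_at \<phi>)
  have int: "integrable (lebesgue_on \<omega>) (\<lambda>x. ?f a b x * ?D c d x)" for a b c d
    by (intro L2_mult_integrable smooth_fun_L2 weak_partial_L2 u \<omega> test_funs_smooth[OF tf])
  \<comment> \<open>Vanishing strain expresses each product \<open>?p a x * ?p b x\<close> by first
    derivatives of the in-plane components.\<close>
  have ae: "AE x in lebesgue_on \<omega>. cof_form \<phi> ?p x =
    - 2 * (?f 2 2 x * ?D 1 1 x) - 2 * (?f 1 1 x * ?D 2 2 x) + 2 * (?f 1 2 x * ?D 1 2 x) + 2 * (?f 1 2 x * ?D 2 1 x)"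
    using strain unfolding zero_in_def
  proof (rule eventually_mono)
    fix x assume "strain \<omega> (u, w) x = 0"
    then have "strain \<omega> (u, w) x $ a $ b = 0" for a b by simp
    then have "?D a b x + ?D b a x + ?p a x * ?p b x = 0" for a b
      unfolding strain_def by simp
    then have p: "?p a x * ?p b x = - (?D a b x + ?D b a x)" for a b
      by (metis add.commute eq_neg_iff_add_eq_0)
    have "cof_form \<phi> ?p x = ?f 2 2 x * (?p 1 x * ?p 1 x) + ?f 1 1 x * (?p 2 x * ?p 2 x) - 2 * ?f 1 2 x * (?p 1 x * ?p 2 x)"
      by (simp add: cof_form_def power2_eq_square)
    then show "cof_form \<phi> ?p x =
      - 2 * (?f 2 2 x * ?D 1 1 x) - 2 * (?f 1 1 x * ?D 2 2 x) + 2 * (?f 1 2 x * ?D 1 2 x) + 2 * (?f 1 2 x * ?D 2 1 x)"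
      unfolding p by (simp add: algebra_simps)
  qed
  have parts: "?I (\<lambda>x. ?f a b x * ?D c d x) = - ?I (\<lambda>x. u d x * pderiv_at c (?f a b) x)" for a b c d
    by (rule weak_partial_test[OF u tf])
  have sm: "smooth_fun \<phi>" "smooth_fun (pderiv_at i \<phi>)" for i
    using \<phi> by (auto intro: test_funs_smooth smooth_fun_pderiv_at)
  have "?I (cof_form \<phi> ?p) = ?I (\<lambda>x.
    - 2 * (?f 2 2 x * ?D 1 1 x) - 2 * (?f 1 1 x * ?D 2 2 x) + 2 * (?f 1 2 x * ?D 1 2 x) + 2 * (?f 1 2 x * ?D 2 1 x))"
    (is "_ = integral\<^sup>L _ ?g")
  proof -
    have "?g \<in> borel_measurable (lebesgue_on \<omega>)"
      by (intro borel_measurable_integrable Bochner_Integration.integrable_add Bochner_Integration.integrable_diff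
          integrable_mult_right int)
    moreover have "cof_form \<phi> ?p \<in> borel_measurable (lebesgue_on \<omega>)"
      by (intro borel_measurable_integrable cof_form_integrable \<omega> weak_partial_L2 w test_funs_smooth[OF \<phi>])
    ultimately show ?thesis by (intro integral_cong_AE ae)
  qed
  also have "\<dots> = 0"
    \<comment> \<open>After integration by parts, \<open>u 1\<close> meets only third derivatives of
      type 1, 2, 2 and \<open>u 2\<close> only those of type 1, 1, 2; by symmetry they cancel in
      pairs.\<close>
    using int parts pderiv_at_commute_fun[OF sm(1), of 1 2]
      pderiv_at_commute_fun[OF sm(2), of 1 2 1] pderiv_at_commute_fun[OF sm(2), of 1 2 2]
    by simp
  finally show ?thesis .
qed

text \<open>Integrating \<open>\<integral> cof (D\<^sup>2 \<psi>) \<nabla>w \<cdot> \<nabla>w\<close> by parts without boundary terms: one factor \<open>\<nabla>w\<close> is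
  approximated by gradients of test functions, so \<open>\<psi>\<close> may be arbitrary near the boundary.\<close>

lemma integral_cof_form_eq_flux:
  assumes \<omega>: "bounded \<omega>" "\<omega> \<in> sets lebesgue"
    and w: "w \<in> H10 \<omega>" "w \<in> H2 \<omega>" and \<psi>: "smooth_fun \<psi>"
    and p_def: "p = (\<lambda>a. weak_partial \<omega> a w)"
  shows "integral\<^sup>L (lebesgue_on \<omega>) (cof_form \<psi> p)
    = integral\<^sup>L (lebesgue_on \<omega>) (\<lambda>x. \<Sum>i\<in>UNIV. pderiv_at i \<psi> x * cof_flux \<omega> p i x)"
proof -
  let ?I = "integral\<^sup>L (lebesgue_on \<omega>)"
  let ?s = "\<lambda>a b. weak_partial \<omega> b (p a)"
  let ?f = "\<lambda>a b. pderiv_at a (pderiv_at b \<psi>)"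
  have p: "p a \<in> H1 \<omega>" for a using w by (simp add: H2_def p_def)
  have L2: "p a \<in> L2 \<omega>" "?s a b \<in> L2 \<omega>" for a b
    using p by (auto intro: H1_L2 weak_partial_L2)
  have sm: "smooth_fun (pderiv_at a \<psi>)" "smooth_fun (?f a b)" for a b
    using \<psi> by (auto intro: smooth_fun_pderiv_at)
  have L2': "(\<lambda>x. pderiv_at c \<psi> x * p a x) \<in> L2 \<omega>" "(\<lambda>x. ?f c d x * p a x) \<in> L2 \<omega>"
    "(\<lambda>x. pderiv_at c \<psi> x * ?s a b x) \<in> L2 \<omega>" for a b c d
    by (intro L2_mult_smooth sm L2 \<omega>)+
  have sym: "?f 2 1 = ?f 1 2" by (rule pderiv_at_commute_fun[OF \<psi>])
  \<comment> \<open>\<open>A\<close> is the field \<open>cof (D^2 \<psi>) p\<close>, whose product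
    with \<open>p\<close> is \<open>cof_form \<psi> p\<close>. In \<open>B\<close> one derivative
    has moved from \<open>\<psi>\<close> to \<open>p\<close>, and its product with \<open>p\<close>
    pairs the gradient of \<open>\<psi>\<close> with \<open>cof_flux\<close>.\<close>
  define A where "A = (\<lambda>a::2. if a = 1 then (\<lambda>x. ?f 2 2 x * p 1 x - ?f 1 2 x * p 2 x)
    else (\<lambda>x. ?f 1 1 x * p 2 x - ?f 1 2 x * p 1 x))"
  define B where "B = (\<lambda>a::2. if a = 1 then (\<lambda>x. pderiv_at 1 \<psi> x * ?s 2 2 x - pderiv_at 2 \<psi> x * ?s 1 2 x)
    else (\<lambda>x. pderiv_at 2 \<psi> x * ?s 1 1 x - pderiv_at 1 \<psi> x * ?s 2 1 x))"
  have AB: "A a \<in> L2 \<omega>" "B a \<in> L2 \<omega>" for a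
    unfolding A_def B_def by (auto intro!: L2_diff L2')
  \<comment> \<open>Moving a derivative off \<open>\<psi>\<close> turns \<open>A\<close> into
    \<open>B\<close> up to terms with second derivatives of \<open>\<phi>\<close>, which cancel by
    symmetry: \<open>A - B\<close> is weakly divergence free.\<close>
  have test: "?I (\<lambda>x. A 1 x * pderiv_at 1 \<phi> x) + ?I (\<lambda>x. A 2 x * pderiv_at 2 \<phi> x)
      = ?I (\<lambda>x. B 1 x * pderiv_at 1 \<phi> x) + ?I (\<lambda>x. B 2 x * pderiv_at 2 \<phi> x)" if \<phi>: "\<phi> \<in> test_funs \<omega>" for \<phi>
  proof -
    have \<phi>L2: "pderiv_at a \<phi> \<in> L2 \<omega>" for a
      by (intro smooth_fun_L2 \<omega> test_funs_smooth[OF test_funs_pderiv_at[OF \<phi>]])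
    note int = L2_mult_integrable[OF L2'(2) \<phi>L2] L2_mult_integrable[OF L2'(3) \<phi>L2]
    have part: "?I (\<lambda>x. ?f a b x * p c x * pderiv_at d \<phi> x) =
        - ?I (\<lambda>x. pderiv_at b \<psi> x * ?s c a x * pderiv_at d \<phi> x)
        - ?I (\<lambda>x. pderiv_at b \<psi> x * p c x * pderiv_at a (pderiv_at d \<phi>) x)" for a b c d
      by (rule weak_partial_product_rule[OF has_L2_weak_partial_weak_partial[OF p] sm(1) test_funs_pderiv_at[OF \<phi>] \<omega>])
    have \<phi>sym: "pderiv_at 2 (pderiv_at 1 \<phi>) = pderiv_at 1 (pderiv_at 2 \<phi>)"
      by (rule pderiv_at_commute_fun[OF test_funs_smooth[OF \<phi>]])
    show ?thesis
      unfolding A_def B_def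
      using int part[of 2 2 1 1] part[of 1 2 1 2] part[of 1 1 2 2] part[of 2 1 2 1]
      by (simp add: left_diff_distrib sym \<phi>sym)
  qed
  obtain \<phi> where \<phi>: "\<And>n. \<phi> n \<in> test_funs \<omega>"
    "\<And>g. g \<in> L2 \<omega> \<Longrightarrow> (\<lambda>n. ?I (\<lambda>x. g x * \<phi> n x)) \<longlonglongrightarrow> ?I (\<lambda>x. g x * w x)"
    "\<And>g i. g \<in> L2 \<omega> \<Longrightarrow> (\<lambda>n. ?I (\<lambda>x. g x * pderiv_at i (\<phi> n) x)) \<longlonglongrightarrow> ?I (\<lambda>x. g x * p i x)"
    using H10_approx[OF w(1) \<omega>] unfolding p_def by blast
  have "(\<lambda>n. ?I (\<lambda>x. A 1 x * pderiv_at 1 (\<phi> n) x) + ?I (\<lambda>x. A 2 x * pderiv_at 2 (\<phi> n) x))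
      \<longlonglongrightarrow> ?I (\<lambda>x. A 1 x * p 1 x) + ?I (\<lambda>x. A 2 x * p 2 x)"
    "(\<lambda>n. ?I (\<lambda>x. A 1 x * pderiv_at 1 (\<phi> n) x) + ?I (\<lambda>x. A 2 x * pderiv_at 2 (\<phi> n) x))
      \<longlonglongrightarrow> ?I (\<lambda>x. B 1 x * p 1 x) + ?I (\<lambda>x. B 2 x * p 2 x)"
    by (intro tendsto_add \<phi>(3) AB) (unfold test[OF \<phi>(1)], intro tendsto_add \<phi>(3) AB)
  from LIMSEQ_unique[OF this]
  have "?I (\<lambda>x. A 1 x * p 1 x) + ?I (\<lambda>x. A 2 x * p 2 x) = ?I (\<lambda>x. B 1 x * p 1 x) + ?I (\<lambda>x. B 2 x * p 2 x)" .
  moreover have "?I (cof_form \<psi> p) = ?I (\<lambda>x. A 1 x * p 1 x + A 2 x * p 2 x)"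
    by (intro arg_cong[where f = ?I] ext) (simp add: cof_form_def A_def power2_eq_square algebra_simps)
  moreover have "?I (\<lambda>x. \<Sum>i\<in>UNIV. pderiv_at i \<psi> x * cof_flux \<omega> p i x) = ?I (\<lambda>x. B 1 x * p 1 x + B 2 x * p 2 x)"
    by (intro arg_cong[where f = ?I] ext) (simp add: cof_flux_def B_def sum_2 algebra_simps)
  ultimately show ?thesis
    using L2_mult_integrable[OF AB(1) L2(1)] L2_mult_integrable[OF AB(2) L2(1)] by simp
qed

text \<open>A product of two square integrable functions is in general merely integrable, which is
  why the flux is paired with bounded functions.\<close>

lemma cof_flux_integrable:
  assumes "\<And>a. p a \<in> H1 \<omega>"
  shows "integrable (lebesgue_on \<omega>) (cof_flux \<omega> p i)"
proof -
  have "integrable (lebesgue_on \<omega>) (\<lambda>x. weak_partial \<omega> c (p a) x * p b x)" for a b c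
    by (intro L2_mult_integrable weak_partial_L2 H1_L2 assms)
  then show ?thesis
    unfolding cof_flux_def by (cases "i = 1") auto
qed

section \<open>Concave exhaustions of convex sets\<close>

lemma pderiv_at_sum:
  assumes "\<And>j. j \<in> J \<Longrightarrow> smooth_fun (f j)"
  shows "pderiv_at i (\<lambda>x. \<Sum>j\<in>J. f j x) x = (\<Sum>j\<in>J. pderiv_at i (f j) x)"
  using assms
  by (induction J rule: infinite_finite_induct)
    (auto simp: pderiv_at_const pderiv_at_add smooth_fun_differentiable smooth_fun_sum)

lemma pderiv_at_cmult:
  assumes "smooth_fun f"
  shows "pderiv_at i (\<lambda>x. c * f x) = (\<lambda>x. c * pderiv_at i f x)"
  using assms by (auto simp: pderiv_at_mult pderiv_at_const smooth_fun_differentiable)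

lemma cof_form_cmult: "smooth_fun \<psi> \<Longrightarrow> cof_form (\<lambda>x. c * \<psi> x) p x = c * cof_form \<psi> p x"
  by (simp add: cof_form_def pderiv_at_cmult smooth_fun_pderiv_at algebra_simps)

section \<open>The log-sum-exp soft maximum\<close>

locale log_sum_exp =
  fixes J :: "'j set" and g :: "'j \<Rightarrow> real^2 \<Rightarrow> real"
  assumes finite: "finite J" and nonempty: "J \<noteq> {}"
    and smooth: "\<And>j. j \<in> J \<Longrightarrow> smooth_fun (g j)"
begin

definition E where "E x = (\<Sum>j\<in>J. exp (g j x))"
text \<open>\<open>L\<close> is a smooth substitute for the maximum of the \<open>g j\<close>: it
  lies between that maximum and the maximum plus \<open>ln (card J)\<close>.\<close>

definition L where "L x = ln (E x)"

lemma E_pos: "E x > 0"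
  unfolding E_def using finite nonempty by (intro sum_pos) auto

lemma smooth_E: "smooth_fun E"
  unfolding E_def by (intro smooth_fun_sum smooth_fun_exp smooth)

lemma smooth_L: "smooth_fun L"
  unfolding L_def by (intro smooth_fun_ln smooth_E E_pos)

lemma g_le_L: "j \<in> J \<Longrightarrow> g j x \<le> L x"
  unfolding L_def using E_pos[of x] finite
  by (subst ln_ge_iff) (auto simp: E_def intro!: member_le_sum)

lemma L_le:
  assumes "\<And>j. j \<in> J \<Longrightarrow> g j x \<le> c"
  shows "L x \<le> ln (card J) + c"
proof -
  have "E x \<le> card J * exp c"
    unfolding E_def using assms by (intro sum_bounded_above) auto
  then have "L x \<le> ln (card J * exp c)"
    unfolding L_def using E_pos[of x] by (intro ln_mono) auto
  also have "\<dots> = ln (card J) + c"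
    using finite nonempty by (simp add: ln_mult card_gt_0_iff)
  finally show ?thesis .
qed

lemma pderiv_at_E: "pderiv_at i E = (\<lambda>x. \<Sum>j\<in>J. exp (g j x) * pderiv_at i (g j) x)"
proof
  fix x
  have "pderiv_at i E x = (\<Sum>j\<in>J. pderiv_at i (\<lambda>x. exp (g j x)) x)"
    unfolding E_def by (intro pderiv_at_sum smooth_fun_exp smooth)
  also have "\<dots> = (\<Sum>j\<in>J. exp (g j x) * pderiv_at i (g j) x)"
    by (intro sum.cong refl pderiv_at_comp smooth_fun_differentiable smooth DERIV_exp)
  finally show "pderiv_at i E x = \<dots>" .
qed

lemma pderiv_at_pderiv_at_E:
  "pderiv_at i (pderiv_at l E) x = (\<Sum>j\<in>J. exp (g j x) *
    (pderiv_at i (g j) x * pderiv_at l (g j) x + pderiv_at i (pderiv_at l (g j)) x))"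
proof -
  have "pderiv_at i (pderiv_at l E) x = (\<Sum>j\<in>J. pderiv_at i (\<lambda>x. exp (g j x) * pderiv_at l (g j) x) x)"
    unfolding pderiv_at_E by (intro pderiv_at_sum smooth_fun_exp smooth smooth_fun_mult smooth_fun_pderiv_at)
  also have "\<dots> = (\<Sum>j\<in>J. exp (g j x) *
    (pderiv_at i (g j) x * pderiv_at l (g j) x + pderiv_at i (pderiv_at l (g j)) x))"
  proof (rule sum.cong)
    fix j assume "j \<in> J"
    then have sm: "g j differentiable at x" "(\<lambda>x. exp (g j x)) differentiable at x"
      "pderiv_at l (g j) differentiable at x"
      by (auto intro!: smooth_fun_differentiable smooth smooth_fun_exp smooth_fun_pderiv_at)
    show "pderiv_at i (\<lambda>x. exp (g j x) * pderiv_at l (g j) x) x = exp (g j x) *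
      (pderiv_at i (g j) x * pderiv_at l (g j) x + pderiv_at i (pderiv_at l (g j)) x)"
      unfolding pderiv_at_mult[OF sm(2,3)] pderiv_at_comp[OF sm(1) DERIV_exp]
      by (simp add: algebra_simps)
  qed simp
  finally show ?thesis .
qed

lemma pderiv_at_L: "pderiv_at i L x = pderiv_at i E x / E x"
  unfolding L_def
  using pderiv_at_comp[OF smooth_fun_differentiable[OF smooth_E] DERIV_ln[OF E_pos]]
  by (simp add: divide_inverse)

lemma pderiv_at_pderiv_at_L:
  "pderiv_at i (pderiv_at l L) x = (E x * pderiv_at i (pderiv_at l E) x - pderiv_at i E x * pderiv_at l E x) / (E x)\<^sup>2"
proof -
  have inv: "(inverse has_real_derivative - (inverse (E x) ^ Suc (Suc 0))) (at (E x))"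
    using E_pos[of x] by (intro DERIV_inverse) simp
  have d: "E differentiable at x" "pderiv_at l E differentiable at x"
    by (auto intro!: smooth_fun_differentiable smooth_E smooth_fun_pderiv_at)
  have i: "(\<lambda>x. inverse (E x)) differentiable at x"
    using has_derivative_real_comp[OF d(1) inv] unfolding differentiable_def by blast
  have "pderiv_at l L = (\<lambda>x. pderiv_at l E x * inverse (E x))"
    by (auto simp: pderiv_at_L divide_inverse)
  then have "pderiv_at i (pderiv_at l L) x = pderiv_at i (\<lambda>x. pderiv_at l E x * inverse (E x)) x"
    by simp
  also have "\<dots> = pderiv_at l E x * (- (inverse (E x) ^ Suc (Suc 0)) * pderiv_at i E x)
      + pderiv_at i (pderiv_at l E) x * inverse (E x)"
    unfolding pderiv_at_mult[OF d(2) i] pderiv_at_comp[OF d(1) inv] ..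
  also have "\<dots> = (E x * pderiv_at i (pderiv_at l E) x - pderiv_at i E x * pderiv_at l E x) / (E x)\<^sup>2"
    using E_pos[of x] by (simp add: field_simps power2_eq_square)
  finally show ?thesis .
qed

text \<open>The gradient of \<open>L\<close> is the average of the gradients of the
  \<open>g j\<close> with weights \<open>exp (g j x) / E x\<close>.\<close>

lemma abs_pderiv_at_L_le:
  assumes "\<And>j. j \<in> J \<Longrightarrow> \<bar>pderiv_at i (g j) x\<bar> \<le> C"
  shows "\<bar>pderiv_at i L x\<bar> \<le> C"
proof -
  have "\<bar>pderiv_at i E x\<bar> \<le> (\<Sum>j\<in>J. \<bar>exp (g j x) * pderiv_at i (g j) x\<bar>)"
    unfolding pderiv_at_E by (rule sum_abs)
  also have "\<dots> \<le> (\<Sum>j\<in>J. exp (g j x) * C)"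
    using assms by (intro sum_mono) (auto simp: abs_mult)
  also have "\<dots> = C * E x" by (simp add: E_def sum_distrib_left mult.commute)
  finally show ?thesis
    using E_pos[of x] by (simp add: pderiv_at_L divide_le_eq)
qed

text \<open>The terms without second derivatives of \<open>g\<close> form a variance with respect to the weights
  \<open>exp (g j x) / E x\<close>.\<close>

lemma cof_form_L_ge:
  "(\<Sum>j\<in>J. exp (g j x) * cof_form (g j) p x) \<le> E x * cof_form L p x"
proof -
  \<comment> \<open>\<open>cof_form\<close> is the Hessian quadratic form in the direction
    \<open>(- p 2 x, p 1 x)\<close>, and \<open>a j\<close> is the derivative of \<open>g j\<close>
    in that direction.\<close>
  define a where "a j = pderiv_at 2 (g j) x * p 1 x - pderiv_at 1 (g j) x * p 2 x" for j
  let ?e = "\<lambda>j. exp (g j x)"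
  have "(\<Sum>j\<in>J. ?e j * a j)\<^sup>2 \<le> (\<Sum>j\<in>J. (sqrt (?e j))\<^sup>2) * (\<Sum>j\<in>J. (sqrt (?e j) * a j)\<^sup>2)"
    using Cauchy_Schwarz_ineq_sum[of "\<lambda>j. sqrt (?e j)" "\<lambda>j. sqrt (?e j) * a j" J]
    by (simp flip: mult.assoc)
  also have "\<dots> = E x * (\<Sum>j\<in>J. ?e j * (a j)\<^sup>2)"
    by (simp add: E_def power_mult_distrib)
  finally have CS: "(\<Sum>j\<in>J. ?e j * a j)\<^sup>2 \<le> E x * (\<Sum>j\<in>J. ?e j * (a j)\<^sup>2)" .
  have E1: "(\<Sum>j\<in>J. ?e j * a j) = pderiv_at 2 E x * p 1 x - pderiv_at 1 E x * p 2 x"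
    by (simp add: pderiv_at_E a_def sum_distrib_right sum_subtractf right_diff_distrib mult.assoc)
  have "(\<Sum>j\<in>J. ?e j * ((a j)\<^sup>2 + cof_form (g j) p x)) = cof_form E p x"
    unfolding cof_form_def pderiv_at_pderiv_at_E a_def
    by (simp add: sum_distrib_left sum_distrib_right power2_eq_square algebra_simps
        flip: sum.distrib sum_subtractf)
  then have E2: "cof_form E p x = (\<Sum>j\<in>J. ?e j * (a j)\<^sup>2) + (\<Sum>j\<in>J. ?e j * cof_form (g j) p x)"
    by (simp add: distrib_left sum.distrib)
  have "E x * E x * cof_form L p x = E x * cof_form E p x
      - (pderiv_at 2 E x * p 1 x - pderiv_at 1 E x * p 2 x)\<^sup>2"
    unfolding cof_form_def pderiv_at_pderiv_at_L
    using E_pos[of x] by (simp add: field_simps power2_eq_square)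
  also have "\<dots> \<ge> E x * (\<Sum>j\<in>J. ?e j * cof_form (g j) p x)"
    using CS unfolding E1 E2 by (simp add: algebra_simps)
  finally show ?thesis
    using E_pos[of x] by (simp add: mult.assoc)
qed

end

section \<open>Supporting lines and a smooth concave soft minimum\<close>

lemma pderiv_at_affine: "pderiv_at i (\<lambda>x::real^2. c + d * (a \<bullet> x)) = (\<lambda>x. d * a $ i)"
proof
  fix x :: "real^2"
  have "((\<lambda>x. c + d * (a \<bullet> x)) has_derivative (\<lambda>v. d * (a \<bullet> v))) (at x)"
    by (auto intro!: derivative_eq_intros)
  from has_derivative_pderiv_at[OF this, of i]
  show "pderiv_at i (\<lambda>x. c + d * (a \<bullet> x)) x = d * a $ i"
    by (simp add: inner_axis)
qed

lemma pderiv_at_quadratic: "pderiv_at i (\<lambda>x::real^2. c + d * (x \<bullet> x)) = (\<lambda>x. 0 + 2 * d * (axis i 1 \<bullet> x))"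
proof
  fix x :: "real^2"
  have "((\<lambda>x. c + d * (x \<bullet> x)) has_derivative (\<lambda>v. d * (x \<bullet> v + v \<bullet> x))) (at x)"
    by (auto intro!: derivative_eq_intros)
  from has_derivative_pderiv_at[OF this, of i]
  show "pderiv_at i (\<lambda>x. c + d * (x \<bullet> x)) x = 0 + 2 * d * (axis i 1 \<bullet> x)"
    by (simp add: inner_commute)
qed

lemma cof_form_affine: "cof_form (\<lambda>x. c + d * (a \<bullet> x)) p x = 0"
  by (simp add: cof_form_def pderiv_at_affine pderiv_at_const)

lemma cof_form_quadratic: "cof_form (\<lambda>x. c + d * (x \<bullet> x)) p x = 2 * d * ((p 1 x)\<^sup>2 + (p 2 x)\<^sup>2)"
  unfolding cof_form_def pderiv_at_quadratic pderiv_at_affine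
  by (simp add: axis_def algebra_simps)

text \<open>Normalising makes \<open>b - a \<bullet> y\<close> the distance from a point
  \<open>y\<close> of the set to the hyperplane, so that all affine pieces built from it can share
  one slope.\<close>

lemma separating_unit_normal:
  fixes \<omega> :: "'a::euclidean_space set"
  assumes "convex \<omega>" "\<omega> \<noteq> {}" "x \<notin> \<omega>"
  obtains a b where "norm a = 1" "\<And>y. y \<in> \<omega> \<Longrightarrow> a \<bullet> y \<le> b" "b \<le> a \<bullet> x"
proof -
  obtain a b where ab: "a \<noteq> 0" "\<forall>y\<in>\<omega>. a \<bullet> y \<le> b" "b \<le> a \<bullet> x"
    using separating_hyperplane_sets[of \<omega> "{x}"] assms by auto
  show thesis
    by (rule that[of "a /\<^sub>R norm a" "b / norm a"])
      (use ab in \<open>auto simp: divide_right_mono divide_inverse mult.commute[of "inverse _"] mult_right_mono\<close>)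
qed

text \<open>Moving from \<open>x\<close> along the unit normal by any length below \<open>r\<close>
  stays in the ball, hence in the half-space.\<close>

lemma ball_subset_halfspace:
  assumes "ball x r \<subseteq> \<omega>" "r > 0" "norm a = 1" "\<And>y. y \<in> \<omega> \<Longrightarrow> a \<bullet> y \<le> b"
  shows "r \<le> b - a \<bullet> x"
proof (rule field_le_epsilon)
  fix e :: real assume "e > 0"
  define s where "s = max 0 (r - e)"
  have "x + s *\<^sub>R a \<in> ball x r"
    using \<open>norm a = 1\<close> \<open>e > 0\<close> \<open>r > 0\<close> by (simp add: s_def dist_norm)
  with assms have "a \<bullet> (x + s *\<^sub>R a) \<le> b" by blast
  then have "a \<bullet> x + s \<le> b"
    using \<open>norm a = 1\<close> by (simp add: inner_add_right dot_square_norm)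
  then show "r \<le> b - a \<bullet> x + e" by (simp add: s_def)
qed

text \<open>The soft minimum of \<open>B - |x|\<^sup>2 / 2\<close> and finitely many affine functions vanishing on supporting
  lines. Its slope is controlled by \<open>m\<close> and \<open>R\<close> only, and it is uniformly concave where the quadratic
  term is the smallest.\<close>

lemma soft_min_exhaustion:
  fixes \<omega> :: "(real^2) set"
  assumes \<omega>: "open \<omega>" "convex \<omega>" "\<omega> \<noteq> {}" and R: "\<And>x. x \<in> \<omega> \<Longrightarrow> norm x \<le> R"
    and m: "m > 0" and \<delta>: "\<delta> > 0"
  obtains S where "smooth_fun S"
    "\<And>i x. x \<in> \<omega> \<Longrightarrow> \<bar>pderiv_at i S x\<bar> \<le> max m R"
    "compact {x. \<delta> \<le> S x}" "{x. \<delta> \<le> S x} \<subseteq> \<omega>"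
    "\<And>x r. ball x r \<subseteq> \<omega> \<Longrightarrow> r > 0 \<Longrightarrow> min 1 (m * r) - \<delta> \<le> S x"
    "\<And>p x. cof_form S p x \<le> 0"
    "\<And>p x r. ball x r \<subseteq> \<omega> \<Longrightarrow> r > 0 \<Longrightarrow> m * r \<ge> R\<^sup>2 / 2 + 2 \<Longrightarrow>
      cof_form S p x \<le> - ((p 1 x)\<^sup>2 + (p 2 x)\<^sup>2) / 2"
proof -
  \<comment> \<open>The summand \<open>1\<close> makes the quadratic piece at least \<open>1\<close>
    on the convex set.\<close>
  define B where "B = R\<^sup>2 / 2 + 1"
  \<comment> \<open>Outside the disc the quadratic piece is negative, so the affine pieces only have
    to be small on the compact remainder \<open>K\<close>.\<close>
  define K where "K = {x. x \<bullet> x / 2 \<le> B} - \<omega>"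
  have "bounded {x::real^2. x \<bullet> x / 2 \<le> B}"
  proof (rule boundedI)
    fix x :: "real^2" assume "x \<in> {x. x \<bullet> x / 2 \<le> B}"
    then have "(norm x)\<^sup>2 \<le> 2 * B" by (simp add: dot_square_norm)
    then show "norm x \<le> sqrt (2 * B)" by (rule real_le_rsqrt)
  qed
  moreover have "closed {x::real^2. x \<bullet> x / 2 \<le> B}"
    by (intro closed_Collect_le continuous_intros) auto
  ultimately have ball: "compact {x::real^2. x \<bullet> x / 2 \<le> B}"
    by (simp add: compact_eq_bounded_closed)
  then have "compact K"
    unfolding K_def using \<omega> by (intro compact_diff)
  have "\<forall>t\<in>K. \<exists>ab. norm (fst ab) = 1 \<and> (\<forall>y\<in>\<omega>. fst ab \<bullet> y \<le> snd ab) \<and> snd ab \<le> fst ab \<bullet> t"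
  proof
    fix t assume "t \<in> K"
    then obtain a b where "norm a = 1" "\<And>y. y \<in> \<omega> \<Longrightarrow> a \<bullet> y \<le> b" "b \<le> a \<bullet> t"
      using separating_unit_normal[OF \<omega>(2,3), of t] unfolding K_def by blast
    then show "\<exists>ab. norm (fst ab) = 1 \<and> (\<forall>y\<in>\<omega>. fst ab \<bullet> y \<le> snd ab) \<and> snd ab \<le> fst ab \<bullet> t"
      by (intro exI[of _ "(a, b)"]) auto
  qed
  from bchoice[OF this] obtain ab where ab: "\<And>t. t \<in> K \<Longrightarrow> norm (fst (ab t)) = 1"
      "\<And>t y. t \<in> K \<Longrightarrow> y \<in> \<omega> \<Longrightarrow> fst (ab t) \<bullet> y \<le> snd (ab t)"
      "\<And>t. t \<in> K \<Longrightarrow> snd (ab t) \<le> fst (ab t) \<bullet> t"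
    by blast
  define a b where "a t = fst (ab t)" and "b t = snd (ab t)" for t
  \<comment> \<open>The affine piece belonging to \<open>t\<close> is at most \<open>0\<close> at
    \<open>t\<close>, hence below \<open>\<delta>\<close> nearby; compactness leaves finitely many
    pieces.\<close>
  define U where "U t = {x. m * (b t - a t \<bullet> x) < \<delta>}" for t
  have "open (U t)" for t
    unfolding U_def by (intro open_Collect_less continuous_intros)
  moreover have "K \<subseteq> (\<Union>t\<in>K. U t)"
  proof
    fix t assume t: "t \<in> K"
    then have "m * (b t - a t \<bullet> t) \<le> 0"
      using ab(3)[OF t] m by (simp add: a_def b_def mult_le_0_iff)
    with t \<delta> show "t \<in> (\<Union>t\<in>K. U t)" by (force simp: U_def)
  qed
  ultimately obtain T where T: "T \<subseteq> K" "finite T" "K \<subseteq> (\<Union>t\<in>T. U t)"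
    using compactE_image[OF \<open>compact K\<close>] by metis
  define J where "J = insert None (Some ` T)"
  \<comment> \<open>The sharpness \<open>k\<close> bounds the error \<open>ln (card J) / k\<close>
    of the soft minimum by \<open>\<delta>\<close> and makes \<open>exp k\<close> at least
    \<open>card J\<close>.\<close>
  define k where "k = 1 + ln (card J) / \<delta> + ln (card J)"
  \<comment> \<open>\<open>None\<close> indexes the quadratic piece. Each \<open>g j\<close> is
    \<open>- k\<close> times its piece, so \<open>- L / k\<close> is a soft minimum of the
    pieces.\<close>
  define g where "g j = (case j of None \<Rightarrow> (\<lambda>x. - (k * B) + (k / 2) * (x \<bullet> x))
    | Some t \<Rightarrow> (\<lambda>x. - (k * m * b t) + (k * m) * (a t \<bullet> x)))" for j
  have g_simps: "g None = (\<lambda>x. - (k * B) + (k / 2) * (x \<bullet> x))"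
    "g (Some t) = (\<lambda>x. - (k * m * b t) + (k * m) * (a t \<bullet> x))" for t
    by (simp_all add: g_def)
  have "smooth_fun (g j)" for j
    unfolding g_def by (cases j; simp only: option.case;
      intro smooth_fun_add smooth_fun_mult smooth_fun_const smooth_fun_inner smooth_fun_inner_self)
  then interpret log_sum_exp J g
    by unfold_locales (auto simp: J_def T)
  have card: "card J = Suc (card T)"
    using T by (simp add: J_def card_image)
  then have "ln (card J) \<ge> 0" by simp
  with \<delta> have k: "k > 0" "ln (card J) \<le> k" "ln (card J) \<le> k * \<delta>"
    by (auto simp: k_def field_simps add_pos_nonneg)
  define S where "S x = (- 1 / k) * L x" for x
  have S: "smooth_fun S"
    unfolding S_def by (intro smooth_fun_mult smooth_fun_const smooth_L)
  have S_le: "S x \<le> - g j x / k" if "j \<in> J" for j x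
    using g_le_L[OF that, of x] k by (simp add: S_def divide_right_mono)
  have S_ge: "c - \<delta> \<le> S x" if "\<And>j. j \<in> J \<Longrightarrow> c \<le> - g j x / k" for c x
  proof -
    have "g j x \<le> - k * c" if "j \<in> J" for j
      using \<open>\<And>j. j \<in> J \<Longrightarrow> c \<le> - g j x / k\<close>[OF that] k by (simp add: field_simps)
    then have "L x \<le> ln (card J) - k * c"
      using L_le[of x "- k * c"] by simp
    also have "\<dots> \<le> k * (\<delta> - c)" using k by (simp add: algebra_simps)
    finally show ?thesis using k by (simp add: S_def field_simps)
  qed
  have gT: "r \<le> b t - a t \<bullet> x" if "t \<in> T" "ball x r \<subseteq> \<omega>" "r > 0" for t x r
    using ball_subset_halfspace[OF that(2,3), of "a t" "b t"] ab(1,2)[of t] T(1) that(1)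
    by (auto simp: a_def b_def)
  have g_Some: "- g (Some t) x / k = m * (b t - a t \<bullet> x)" for t x
    using k by (simp add: g_def field_simps)
  have g_None: "- g None x / k = B - x \<bullet> x / 2" for x
    using k by (simp add: g_def field_simps)
  have q: "1 \<le> - g None x / k" if "x \<in> \<omega>" for x
    using power_mono[OF R[OF that], of 2] unfolding g_None by (simp add: B_def dot_square_norm)
  show thesis
  proof (rule that[OF S])
    fix i x assume x: "x \<in> \<omega>"
    have "\<bar>pderiv_at i L x\<bar> \<le> k * max m R"
    proof (rule abs_pderiv_at_L_le)
      fix j assume "j \<in> J"
      then consider "j = None" | t where "j = Some t" "t \<in> T" by (auto simp: J_def)
      then show "\<bar>pderiv_at i (g j) x\<bar> \<le> k * max m R"
      proof cases
        case 1
        have "\<bar>x $ i\<bar> \<le> max m R"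
          using component_le_norm_cart[of x i] R[OF x] by simp
        with 1 k show ?thesis
          unfolding 1 g_simps pderiv_at_quadratic by (simp add: inner_axis' abs_mult)
      next
        case 2
        have "norm (a t) = 1" using ab(1)[of t] T(1) 2 by (auto simp: a_def)
        then have "m * \<bar>a t $ i\<bar> \<le> m * 1"
          using component_le_norm_cart[of "a t" i] m by (intro mult_left_mono) auto
        then have "m * \<bar>a t $ i\<bar> \<le> max m R" by simp
        with 2 k m show ?thesis
          unfolding 2 g_simps pderiv_at_affine by (simp add: abs_mult mult.assoc)
      qed
    qed
    then show "\<bar>pderiv_at i S x\<bar> \<le> max m R"
      unfolding S_def pderiv_at_cmult[OF smooth_L] using k by (simp add: abs_mult divide_le_eq mult.commute)
  next
    \<comment> \<open>Since \<open>S\<close> lies below every piece,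
      \<open>\<delta> \<le> S x\<close> excludes the exterior of the disc and, by the covering, the
      points of \<open>K\<close>.\<close>
    have *: "x \<in> {x. x \<bullet> x / 2 \<le> B}" "x \<in> \<omega>" if "\<delta> \<le> S x" for x
    proof -
      have "\<delta> \<le> B - x \<bullet> x / 2"
        using that S_le[of None x] unfolding g_None by (simp add: J_def)
      with \<delta> show x: "x \<in> {x. x \<bullet> x / 2 \<le> B}" by simp
      show "x \<in> \<omega>"
      proof (rule ccontr)
        assume "x \<notin> \<omega>"
        with x have "x \<in> K" by (simp add: K_def)
        with T obtain t where "t \<in> T" "m * (b t - a t \<bullet> x) < \<delta>" by (auto simp: U_def)
        with that S_le[of "Some t" x] show False unfolding g_Some by (simp add: J_def)
      qed
    qed
    then show "{x. \<delta> \<le> S x} \<subseteq> \<omega>" by blast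
    have "closed {x. \<delta> \<le> S x}"
      using smooth_fun_continuous[OF S, of UNIV] by (intro closed_Collect_le continuous_intros)
    then have "compact ({x. x \<bullet> x / 2 \<le> B} \<inter> {x. \<delta> \<le> S x})"
      using ball by (rule compact_Int_closed[rotated])
    moreover have "{x. x \<bullet> x / 2 \<le> B} \<inter> {x. \<delta> \<le> S x} = {x. \<delta> \<le> S x}" using * by blast
    ultimately show "compact {x. \<delta> \<le> S x}" by simp
  next
    fix x and r :: real assume r: "ball x r \<subseteq> \<omega>" "r > 0"
    then have "x \<in> \<omega>" by auto
    show "min 1 (m * r) - \<delta> \<le> S x"
    proof (rule S_ge)
      fix j assume "j \<in> J"
      then consider "j = None" | t where "j = Some t" "t \<in> T" by (auto simp: J_def)
      then show "min 1 (m * r) \<le> - g j x / k"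
      proof cases
        case 1
        then show ?thesis using q[OF \<open>x \<in> \<omega>\<close>] by simp
      next
        case 2
        have "m * r \<le> m * (b t - a t \<bullet> x)"
          using gT[OF 2(2) r] m by (intro mult_left_mono) auto
        then show ?thesis unfolding 2 g_Some by simp
      qed
    qed
  next
    fix p :: "2 \<Rightarrow> real^2 \<Rightarrow> real" and x :: "real^2"
    let ?e = "exp (g None x)" and ?p2 = "(p 1 x)\<^sup>2 + (p 2 x)\<^sup>2"
    have cof_g: "cof_form (g None) p x = k * ?p2" "cof_form (g (Some t)) p x = 0" for t
      unfolding g_simps cof_form_quadratic cof_form_affine by simp_all
    \<comment> \<open>Affine pieces have zero Hessian, so only the quadratic one
      contributes.\<close>
    have "(\<Sum>j\<in>J. exp (g j x) * cof_form (g j) p x) = ?e * (k * ?p2)"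
      using T by (simp add: J_def sum.reindex cof_g)
    then have "?e * (k * ?p2) \<le> E x * cof_form L p x"
      using cof_form_L_ge[where x = x and p = p] by simp
    then have "?e * (k * ?p2) / k \<le> E x * cof_form L p x / k"
      using k by (intro divide_right_mono) auto
    then have le: "E x * cof_form S p x \<le> - (?e * ?p2)"
      using k unfolding S_def cof_form_cmult[OF smooth_L] by simp
    then have "E x * cof_form S p x \<le> 0"
      by (rule order_trans) simp
    then show "cof_form S p x \<le> 0"
      using E_pos[of x] by (simp add: mult_le_0_iff)
    fix r :: real assume r: "ball x r \<subseteq> \<omega>" "r > 0" "m * r \<ge> R\<^sup>2 / 2 + 2"
    \<comment> \<open>Here every affine piece exceeds the quadratic one by at least
      \<open>1\<close>, because \<open>R^2 / 2 + 2 = B + 1\<close>; this costs its weight a factor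
      \<open>exp (- k)\<close>.\<close>
    have "exp (g (Some t) x) \<le> ?e * exp (- k)" if "t \<in> T" for t
    proof -
      have "m * r \<le> m * (b t - a t \<bullet> x)"
        using gT[OF that r(1,2)] m by (intro mult_left_mono) auto
      then have "- g None x / k + 1 \<le> - g (Some t) x / k"
        using r(3) inner_ge_zero[of x] unfolding g_Some g_None B_def by linarith
      then have "(k + g (Some t) x) / k \<le> g None x / k" using k by (simp add: add_divide_distrib)
      then have "g (Some t) x \<le> g None x - k" using k by (simp add: divide_le_cancel)
      then show ?thesis by (simp flip: exp_add)
    qed
    then have "(\<Sum>t\<in>T. exp (g (Some t) x)) \<le> card T * (?e * exp (- k))"
      by (rule sum_bounded_above)
    also have "\<dots> \<le> exp k * (?e * exp (- k))"
    proof (rule mult_right_mono)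
      have "real (card T) \<le> card J" using card by simp
      also have "\<dots> = exp (ln (card J))" using card by simp
      also have "\<dots> \<le> exp k" using k by simp
      finally show "real (card T) \<le> exp k" .
    qed simp
    also have "\<dots> = ?e" by (simp add: exp_minus)
    \<comment> \<open>The quadratic piece carries at least half of the total weight, whence the
      factor \<open>1 / 2\<close> in the concavity bound.\<close>
    finally have "E x \<le> 2 * ?e"
      unfolding E_def unfolding J_def using T by (simp add: sum.reindex)
    then have "E x * ?p2 / 2 \<le> ?e * ?p2"
      using mult_right_mono[of "E x" "2 * ?e" ?p2] by simp
    moreover have "E x * (- ?p2 / 2) = - (E x * ?p2 / 2)"
      by (simp only: times_divide_eq_right mult_minus_right minus_divide_left)
    ultimately have "E x * cof_form S p x \<le> E x * (- ?p2 / 2)"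
      using le by linarith
    then show "cof_form S p x \<le> - ?p2 / 2"
      using E_pos[of x] by (simp only: mult_le_cancel_left_pos)
  qed
qed

section \<open>Uniqueness for the Monge-Ampere equation\<close>

text \<open>The derivative of \<open>y \<mapsto> y exp (- 1 / y)\<close>.\<close>

definition flat_slope :: "real \<Rightarrow> real"
  where "flat_slope y = flat_fun 1 y + y * flat_fun [:0, 0, 1:] y"

lemma flat_slope_eq: "flat_slope y = (if y > 0 then (1 + inverse y) * exp (- inverse y) else 0)"
  by (simp add: flat_slope_def flat_fun_def field_simps)

lemma flat_slope_nonneg: "0 \<le> flat_slope y"
  by (simp add: flat_slope_eq)

text \<open>This is \<open>1 + z \<le> exp z\<close> for \<open>z = inverse y\<close>.\<close>

lemma flat_slope_le_1: "flat_slope y \<le> 1"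
  using mult_right_mono[OF exp_ge_add_one_self[of "inverse y"], of "exp (- inverse y)"]
  by (simp add: flat_slope_eq flip: exp_add)

lemma flat_slope_tendsto: "(flat_slope \<longlongrightarrow> 1) at_top"
proof -
  have "((\<lambda>y::real. (1 + inverse y) * exp (- inverse y)) \<longlongrightarrow> (1 + 0) * exp (- 0)) at_top"
    by (intro tendsto_intros tendsto_inverse_0_at_top filterlim_ident)
  moreover have "\<forall>\<^sub>F y in at_top. (1 + inverse y) * exp (- inverse y) = flat_slope y"
    using eventually_gt_at_top[of 0] by eventually_elim (simp add: flat_slope_eq)
  ultimately show ?thesis
    by (simp add: tendsto_cong)
qed

text \<open>The truncation is \<open>F (N S - 1) / N\<close> with
  \<open>F y = y exp (- 1 / y)\<close>, extended by zero. The two scalings cancel in the gradient,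
  which is that of \<open>S\<close> times a number between \<open>0\<close> and \<open>1\<close> and
  does not blow up as \<open>N\<close> grows.\<close>

lemma flat_truncation:
  assumes S: "smooth_fun S" and N: "N > 0"
    and supp: "compact {x. 1 / N \<le> S x}" "{x. 1 / N \<le> S x} \<subseteq> \<omega>"
  defines "T \<equiv> \<lambda>x. (1 / N) * ((N * S x - 1) * flat_fun 1 (N * S x - 1))"
  shows "T \<in> test_funs \<omega>" and "pderiv_at i T x = flat_slope (N * S x - 1) * pderiv_at i S x"
proof -
  let ?Y = "\<lambda>x. N * S x - 1"
  have Y: "smooth_fun ?Y" by (intro smooth_fun_diff smooth_fun_mult smooth_fun_const S)
  have F: "smooth_fun (\<lambda>x. flat_fun 1 (?Y x))" by (rule smooth_fun_flat_fun[OF Y])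
  have T: "smooth_fun T"
    unfolding T_def by (intro smooth_fun_mult smooth_fun_const Y F)
  have "T x = 0" if "x \<notin> {x. 1 / N \<le> S x}" for x
    using that N by (simp add: T_def flat_fun_def field_simps)
  with T supp show "T \<in> test_funs \<omega>"
    unfolding test_funs_iff by blast
  have dY: "pderiv_at i ?Y x = N * pderiv_at i S x"
    using S pderiv_at_add[of "\<lambda>x. N * S x" x "\<lambda>_. -1" i]
    by (simp add: pderiv_at_cmult pderiv_at_const smooth_fun_differentiable smooth_fun_mult smooth_fun_const)
  have "pderiv_at i T x = (1 / N) * pderiv_at i (\<lambda>x. ?Y x * flat_fun 1 (?Y x)) x"
    unfolding T_def by (subst pderiv_at_cmult[OF smooth_fun_mult[OF Y F]]) simp
  also have "pderiv_at i (\<lambda>x. ?Y x * flat_fun 1 (?Y x)) x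
      = ?Y x * (flat_fun ([:0, 0, 1:] * (1 - pderiv 1)) (?Y x) * pderiv_at i ?Y x) + pderiv_at i ?Y x * flat_fun 1 (?Y x)"
    by (subst pderiv_at_mult)
      (use Y F in \<open>auto simp: smooth_fun_differentiable pderiv_at_comp[OF _ flat_fun_has_derivative]\<close>)
  finally show "pderiv_at i T x = flat_slope (N * S x - 1) * pderiv_at i S x"
  proof (rule trans)
    let ?F = "flat_fun [:0, 0, 1:] (?Y x)"
    have "?Y x * (?F * (N * pderiv_at i S x)) + N * pderiv_at i S x * flat_fun 1 (?Y x)
        = N * (flat_slope (?Y x) * pderiv_at i S x)"
      unfolding flat_slope_def by (simp only: algebra_simps)
    then show "(1 / N) * (?Y x * (flat_fun ([:0, 0, 1:] * (1 - pderiv 1)) (?Y x) * pderiv_at i ?Y x)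
        + pderiv_at i ?Y x * flat_fun 1 (?Y x)) = flat_slope (?Y x) * pderiv_at i S x"
      using N unfolding dY by (simp add: pderiv_1)
  qed
qed

lemma smooth_mult_integrable:
  assumes "smooth_fun g" "bounded \<omega>" "\<omega> \<in> sets lebesgue" and f: "integrable (lebesgue_on \<omega>) f"
  shows "integrable (lebesgue_on \<omega>) (\<lambda>x. g x * f x)"
proof -
  obtain C where C: "\<And>x. x \<in> \<omega> \<Longrightarrow> \<bar>g x\<bar> \<le> C"
    using smooth_fun_bounded assms by blast
  show ?thesis
  proof (rule Bochner_Integration.integrable_bound)
    show "integrable (lebesgue_on \<omega>) (\<lambda>x. C * f x)" using f by simp
    have "\<bar>g x * f x\<bar> \<le> \<bar>C * f x\<bar>" if "x \<in> \<omega>" for x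
      using C[OF that] by (simp add: abs_mult mult_right_mono)
    then show "AE x in lebesgue_on \<omega>. norm (g x * f x) \<le> norm (C * f x)"
      by (intro AE_I2) simp
  qed (use f smooth_fun_measurable[OF assms(1,3)] in auto)
qed

lemma gradient_zero_off_boundary_layer:
  fixes \<omega> :: "(real^2) set"
  assumes \<omega>: "bounded \<omega>" "convex \<omega>" "open \<omega>" "\<omega> \<noteq> {}"
    and w: "w \<in> H10 \<omega>" "w \<in> H2 \<omega>"
    and p_def: "p = (\<lambda>a. weak_partial \<omega> a w)"
    and MA: "\<And>\<phi>. \<phi> \<in> test_funs \<omega> \<Longrightarrow> integral\<^sup>L (lebesgue_on \<omega>) (cof_form \<phi> p) = 0"
    and r: "r > 0"
  shows "AE x in lebesgue_on \<omega>. ball x r \<subseteq> \<omega> \<longrightarrow> p a x = 0"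
proof -
  let ?I = "integral\<^sup>L (lebesgue_on \<omega>)"
  have \<omega>s: "\<omega> \<in> sets lebesgue" using \<omega>(3) by simp
  obtain R where R: "R > 0" "\<And>x. x \<in> \<omega> \<Longrightarrow> norm x \<le> R"
    using \<omega>(1) by (auto simp: bounded_pos)
  \<comment> \<open>This slope lets the affine pieces exceed the quadratic one wherever a ball of
    radius \<open>r\<close> fits into the set.\<close>
  define m where "m = (R\<^sup>2 / 2 + 2) / r"
  have m: "m > 0" "m * r \<ge> R\<^sup>2 / 2 + 2" using r by (auto simp: m_def add_nonneg_pos)
  define C where "C = max m R"
  have p: "p a \<in> H1 \<omega>" "p a \<in> L2 \<omega>" for a
    using w by (auto simp: H2_def p_def intro: H1_L2)
  have "\<exists>S. smooth_fun S
    \<and> (\<forall>i. \<forall>x\<in>\<omega>. \<bar>pderiv_at i S x\<bar> \<le> C)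
    \<and> compact {x. 1 / real (Suc n) \<le> S x} \<and> {x. 1 / real (Suc n) \<le> S x} \<subseteq> \<omega>
    \<and> (\<forall>x s. ball x s \<subseteq> \<omega> \<longrightarrow> s > 0 \<longrightarrow> min 1 (m * s) - 1 / real (Suc n) \<le> S x)
    \<and> (\<forall>x. cof_form S p x \<le> 0)
    \<and> (\<forall>x. ball x r \<subseteq> \<omega> \<longrightarrow> cof_form S p x \<le> - ((p 1 x)\<^sup>2 + (p 2 x)\<^sup>2) / 2)" for n
  proof -
    have "1 / real (Suc n) > 0" by simp
    from soft_min_exhaustion[OF \<omega>(3,2,4) R(2) m(1) this]
    obtain S where "smooth_fun S"
      "\<And>i x. x \<in> \<omega> \<Longrightarrow> \<bar>pderiv_at i S x\<bar> \<le> max m R"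
      "compact {x. 1 / real (Suc n) \<le> S x}" "{x. 1 / real (Suc n) \<le> S x} \<subseteq> \<omega>"
      "\<And>x s. ball x s \<subseteq> \<omega> \<Longrightarrow> s > 0 \<Longrightarrow> min 1 (m * s) - 1 / real (Suc n) \<le> S x"
      "\<And>p x. cof_form S p x \<le> 0"
      "\<And>p x r. ball x r \<subseteq> \<omega> \<Longrightarrow> r > 0 \<Longrightarrow> m * r \<ge> R\<^sup>2 / 2 + 2 \<Longrightarrow>
        cof_form S p x \<le> - ((p 1 x)\<^sup>2 + (p 2 x)\<^sup>2) / 2"
      by blast
    then show ?thesis
      using r m(2) by (intro exI[of _ S]) (auto simp: C_def)
  qed
  then obtain S where S: "\<And>n. smooth_fun (S n)"
    "\<And>n i x. x \<in> \<omega> \<Longrightarrow> \<bar>pderiv_at i (S n) x\<bar> \<le> C"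
    "\<And>n. compact {x. 1 / real (Suc n) \<le> S n x}" "\<And>n. {x. 1 / real (Suc n) \<le> S n x} \<subseteq> \<omega>"
    "\<And>n x s. ball x s \<subseteq> \<omega> \<Longrightarrow> s > 0 \<Longrightarrow> min 1 (m * s) - 1 / real (Suc n) \<le> S n x"
    "\<And>n x. cof_form (S n) p x \<le> 0"
    "\<And>n x. ball x r \<subseteq> \<omega> \<Longrightarrow> cof_form (S n) p x \<le> - ((p 1 x)\<^sup>2 + (p 2 x)\<^sup>2) / 2"
    by metis
  define Y where "Y n x = real (Suc n) * S n x - 1" for n x
  define T where "T n = (\<lambda>x. (1 / real (Suc n)) * ((real (Suc n) * S n x - 1) * flat_fun 1 (real (Suc n) * S n x - 1)))" for n
  have T: "T n \<in> test_funs \<omega>" "pderiv_at i (T n) x = flat_slope (Y n x) * pderiv_at i (S n) x" for n i x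
    unfolding T_def Y_def by (rule flat_truncation; use S in simp)+
  \<comment> \<open>The part of the flux pairing that is lost by truncating \<open>S n\<close> to
    \<open>T n\<close>.\<close>
  let ?G = "\<lambda>n x. \<Sum>i\<in>UNIV. (1 - flat_slope (Y n x)) * (pderiv_at i (S n) x * cof_flux \<omega> p i x)"
  have flux: "integrable (lebesgue_on \<omega>) (cof_flux \<omega> p i)" for i
    by (rule cof_flux_integrable[OF p(1)])
  have int: "integrable (lebesgue_on \<omega>) (\<lambda>x. pderiv_at i \<psi> x * cof_flux \<omega> p i x)" if "smooth_fun \<psi>" for i \<psi>
    by (intro smooth_mult_integrable smooth_fun_pderiv_at that \<omega>(1) \<omega>s flux)
  have cof: "?I (cof_form (S n) p) = ?I (?G n)" for n
  proof -
    have "?I (cof_form (S n) p) = ?I (cof_form (S n) p) - ?I (cof_form (T n) p)"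
      using MA[OF T(1)] by simp
    also have "\<dots> = ?I (\<lambda>x. (\<Sum>i\<in>UNIV. pderiv_at i (S n) x * cof_flux \<omega> p i x)
        - (\<Sum>i\<in>UNIV. pderiv_at i (T n) x * cof_flux \<omega> p i x))"
      using integral_cof_form_eq_flux[OF \<omega>(1) \<omega>s w S(1) p_def]
        integral_cof_form_eq_flux[OF \<omega>(1) \<omega>s w test_funs_smooth[OF T(1)] p_def]
        int[OF S(1)] int[OF test_funs_smooth[OF T(1)]]
      by simp
    also have "\<dots> = ?I (?G n)"
      unfolding T(2) by (intro arg_cong[where f = ?I] ext) (simp add: sum_2 algebra_simps)
    finally show ?thesis .
  qed
  \<comment> \<open>The gradient bound \<open>C\<close> is independent of \<open>n\<close>, so
    integrability of the flux suffices for dominated convergence.\<close>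
  have "(\<lambda>n. ?I (?G n)) \<longlonglongrightarrow> ?I (\<lambda>x. 0)"
  proof (rule integral_dominated_convergence[where w = "\<lambda>x. \<Sum>i\<in>UNIV. C * \<bar>cof_flux \<omega> p i x\<bar>"])
    show "integrable (lebesgue_on \<omega>) (\<lambda>x. \<Sum>i\<in>UNIV. C * \<bar>cof_flux \<omega> p i x\<bar>)"
      using flux by simp
    show "?G n \<in> borel_measurable (lebesgue_on \<omega>)" for n
    proof -
      have "?G n = (\<lambda>x. (\<Sum>i\<in>UNIV. pderiv_at i (S n) x * cof_flux \<omega> p i x)
        - (\<Sum>i\<in>UNIV. pderiv_at i (T n) x * cof_flux \<omega> p i x))"
        unfolding T(2) by (intro ext) (simp add: sum_2 algebra_simps)
      then show ?thesis
        using int[OF S(1)] int[OF test_funs_smooth[OF T(1)]]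
        by (auto intro!: borel_measurable_integrable)
    qed
    have "norm (?G n x) \<le> (\<Sum>i\<in>UNIV. C * \<bar>cof_flux \<omega> p i x\<bar>)" if x: "x \<in> \<omega>" for n x
      unfolding real_norm_def
    proof (rule order_trans[OF sum_abs sum_mono])
      fix i
      have "\<bar>1 - flat_slope (Y n x)\<bar> * (\<bar>pderiv_at i (S n) x\<bar> * \<bar>cof_flux \<omega> p i x\<bar>) \<le> 1 * (C * \<bar>cof_flux \<omega> p i x\<bar>)"
        using flat_slope_nonneg[of "Y n x"] flat_slope_le_1[of "Y n x"] S(2)[OF x, of i n]
        by (intro mult_mono) auto
      then show "\<bar>(1 - flat_slope (Y n x)) * (pderiv_at i (S n) x * cof_flux \<omega> p i x)\<bar> \<le> C * \<bar>cof_flux \<omega> p i x\<bar>"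
        by (simp add: abs_mult)
    qed
    then show "AE x in lebesgue_on \<omega>. norm (?G n x) \<le> (\<Sum>i\<in>UNIV. C * \<bar>cof_flux \<omega> p i x\<bar>)" for n
      by (intro AE_I2) simp
    have "(\<lambda>n. ?G n x) \<longlonglongrightarrow> 0" if x: "x \<in> \<omega>" for x
    proof -
      obtain s where s: "s > 0" "ball x s \<subseteq> \<omega>"
        using \<omega>(3) x open_contains_ball by blast
      define c where "c = min 1 (m * s)"
      have "c > 0" using s m by (simp add: c_def)
      \<comment> \<open>Of the constant \<open>2\<close>, one unit is the error
        \<open>1 / Suc n\<close> in the lower bound for \<open>S n\<close> after scaling, the other
        is the shift in \<open>Y\<close>.\<close>
      have le: "c * real (Suc n) - 2 \<le> Y n x" for n
        using mult_left_mono[OF S(5)[OF s(2,1), of n], of "real (Suc n)"]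
        by (simp add: Y_def c_def algebra_simps del: of_nat_Suc)
      have "filterlim (\<lambda>n. c * real (Suc n) - 2) at_top sequentially"
      proof -
        have "filterlim (\<lambda>n. - 2 + c * real (Suc n)) at_top sequentially"
          using \<open>c > 0\<close> by (intro filterlim_tendsto_add_at_top[OF tendsto_const]
              filterlim_tendsto_pos_mult_at_top[OF tendsto_const]
              filterlim_compose[OF filterlim_real_sequentially] filterlim_Suc)
        then show ?thesis by (simp add: algebra_simps)
      qed
      then have "filterlim (\<lambda>n. Y n x) at_top sequentially"
        by (rule filterlim_at_top_mono) (intro always_eventually allI le)
      then have "(\<lambda>n. flat_slope (Y n x)) \<longlonglongrightarrow> 1"
        by (rule filterlim_compose[OF flat_slope_tendsto])
      then have lim: "(\<lambda>n. \<bar>1 - flat_slope (Y n x)\<bar>) \<longlonglongrightarrow> 0"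
        using tendsto_diff[OF tendsto_const[of 1]] by (intro tendsto_rabs_zero) fastforce
      have "(\<lambda>n. (1 - flat_slope (Y n x)) * (pderiv_at i (S n) x * cof_flux \<omega> p i x)) \<longlonglongrightarrow> 0" for i
      proof (rule Lim_null_comparison)
        show "\<forall>\<^sub>F n in sequentially. norm ((1 - flat_slope (Y n x)) * (pderiv_at i (S n) x * cof_flux \<omega> p i x))
            \<le> \<bar>1 - flat_slope (Y n x)\<bar> * (C * \<bar>cof_flux \<omega> p i x\<bar>)"
          using S(2)[OF x] by (simp add: abs_mult mult_left_mono mult_right_mono)
        show "(\<lambda>n. \<bar>1 - flat_slope (Y n x)\<bar> * (C * \<bar>cof_flux \<omega> p i x\<bar>)) \<longlonglongrightarrow> 0"
          using tendsto_mult_right[OF lim] by simp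
      qed
      then show ?thesis
        using tendsto_add[of "\<lambda>n. (1 - flat_slope (Y n x)) * (pderiv_at 1 (S n) x * cof_flux \<omega> p 1 x)" 0 sequentially
            "\<lambda>n. (1 - flat_slope (Y n x)) * (pderiv_at 2 (S n) x * cof_flux \<omega> p 2 x)" 0]
        by (simp add: sum_2)
    qed
    then show "AE x in lebesgue_on \<omega>. (\<lambda>n. ?G n x) \<longlonglongrightarrow> 0"
      by (intro AE_I2) simp
  qed simp
  then have lim: "(\<lambda>n. - ?I (cof_form (S n) p)) \<longlonglongrightarrow> 0"
    using tendsto_minus[of "\<lambda>n. ?I (?G n)" 0] by (simp add: cof)
  define A where "A = {x. ball x r \<subseteq> \<omega>}"
  \<comment> \<open>Closedness of \<open>A\<close> provides the measurability of its
    indicator.\<close>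
  have "A = - (\<Union>y\<in>- \<omega>. ball y r)"
    by (auto simp: A_def dist_commute)
  moreover have "open (\<Union>y\<in>- \<omega>. ball y r)" by blast
  ultimately have "closed A" by (simp only: closed_Compl)
  then have A: "indicat_real A \<in> borel_measurable (lebesgue_on \<omega>)"
    by (intro measurable_restrict_space1 borel_measurable_indicator) simp
  define f where "f x = indicator A x * (((p 1 x)\<^sup>2 + (p 2 x)\<^sup>2) / 2)" for x
  have f_int: "integrable (lebesgue_on \<omega>) f"
  proof -
    have "(\<lambda>x. indicator A x * p a x) \<in> L2 \<omega>" for a
      by (rule L2_mult_bounded[OF p(2) A, of 1]) (simp add: indicator_def)
    then have "integrable (lebesgue_on \<omega>) (\<lambda>x. indicator A x * p a x * p a x)" for a
      by (intro L2_mult_integrable p)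
    then have "integrable (lebesgue_on \<omega>) (\<lambda>x. (indicator A x * p 1 x * p 1 x + indicator A x * p 2 x * p 2 x) / 2)"
      by simp
    moreover have "(\<lambda>x. (indicator A x * p 1 x * p 1 x + indicator A x * p 2 x * p 2 x) / 2) = f"
      by (auto simp: f_def power2_eq_square algebra_simps)
    ultimately show ?thesis by simp
  qed
  \<comment> \<open>On \<open>A\<close> uniform concavity is used, elsewhere only the sign of
    \<open>cof_form (S n) p\<close>.\<close>
  have "?I f \<le> - ?I (cof_form (S n) p)" for n
  proof -
    have "?I f \<le> ?I (\<lambda>x. - cof_form (S n) p x)"
    proof (rule integral_mono[OF f_int])
      show "integrable (lebesgue_on \<omega>) (\<lambda>x. - cof_form (S n) p x)"
        using cof_form_integrable[OF \<omega>(1) \<omega>s p(2) S(1)] by simp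
      show "f x \<le> - cof_form (S n) p x" for x
        using S(6)[of n x] S(7)[of x n] by (auto simp: f_def A_def indicator_def)
    qed
    then show ?thesis by simp
  qed
  then have "?I f \<le> 0"
    using lim by (intro LIMSEQ_le_const) auto
  moreover have "0 \<le> ?I f"
    by (intro integral_nonneg_AE AE_I2) (simp add: f_def)
  ultimately have "?I f = 0" by simp
  then have "AE x in lebesgue_on \<omega>. f x = 0"
    by (subst (asm) integral_nonneg_eq_0_iff_AE[OF f_int]) (auto simp: f_def)
  then show ?thesis
  proof (rule eventually_mono)
    fix x assume "f x = 0"
    then have "ball x r \<subseteq> \<omega> \<longrightarrow> p 1 x = 0 \<and> p 2 x = 0"
      by (auto simp: f_def A_def indicator_def add_nonneg_eq_0_iff)
    then show "ball x r \<subseteq> \<omega> \<longrightarrow> p a x = 0"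
      using exhaust_2[of a] by auto
  qed
qed

lemma very_weak_Monge_Ampere_uniqueness:
  fixes \<omega> :: "(real^2) set"
  assumes \<omega>: "bounded \<omega>" "convex \<omega>" "open \<omega>"
    and w: "w \<in> H10 \<omega>" "w \<in> H2 \<omega>"
    and MA: "\<And>\<phi>. \<phi> \<in> test_funs \<omega> \<Longrightarrow>
      integral\<^sup>L (lebesgue_on \<omega>) (cof_form \<phi> (\<lambda>a. weak_partial \<omega> a w)) = 0"
  shows "zero_in \<omega> (weak_partial \<omega> a w)"
proof (cases "\<omega> = {}")
  case True
  then show ?thesis by (auto simp: zero_in_def intro: AE_I2)
next
  case False
  \<comment> \<open>Countably many radii exhaust the open set, so their null sets can be
    united.\<close>
  have "AE x in lebesgue_on \<omega>. \<forall>n. ball x (1 / real (Suc n)) \<subseteq> \<omega> \<longrightarrow> weak_partial \<omega> a w x = 0"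
    unfolding AE_all_countable
    using gradient_zero_off_boundary_layer[OF \<omega> False w refl MA] by simp
  moreover have "AE x in lebesgue_on \<omega>. x \<in> \<omega>"
    by (rule AE_I2) simp
  ultimately have "AE x in lebesgue_on \<omega>. weak_partial \<omega> a w x = 0"
  proof eventually_elim
    case (elim x)
    then obtain e where e: "e > 0" "ball x e \<subseteq> \<omega>"
      using \<omega>(3) open_contains_ball by blast
    then obtain n where "1 / real (Suc n) < e"
      using nat_approx_posE by blast
    then have "ball x (1 / real (Suc n)) \<subseteq> \<omega>"
      using e subset_ball[of "1 / real (Suc n)" e x] by auto
    with elim show ?case by blast
  qed
  then show ?thesis by (simp add: zero_in_def)
qed

section \<open>Rigidity of the Hessian and of the nonlinear strain\<close>

theorem theorem3:
  fixes \<omega> :: "(real^2) set"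
    and V_H :: "(2 \<Rightarrow> real^2 \<Rightarrow> real) set"
    and V_3 :: "(real^2 \<Rightarrow> real) set"
    and V :: "displacement set"
  assumes "bounded \<omega>" and "convex \<omega>" and "open \<omega>" and "\<omega> \<noteq> UNIV"
    and "V = V_H \<times> V_3"
    and "V_H \<subseteq> {uH. \<forall>\<alpha>. uH \<alpha> \<in> H1 \<omega>}"
    and "V_3 \<subseteq> H2 \<omega>"
    and "\<And>uH. \<lbrakk>uH \<in> V_H;
           \<forall>\<alpha> \<beta>. zero_in \<omega> (\<lambda>x. weak_partial \<omega> \<alpha> (uH \<beta>) x + weak_partial \<omega> \<beta> (uH \<alpha>) x)\<rbrakk>
         \<Longrightarrow> \<forall>\<alpha>. zero_in \<omega> (uH \<alpha>)"
    and "\<And>u3. u3 \<in> V_3 \<Longrightarrow> u3 \<in> H10 \<omega>"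
  shows "(\<forall>u3\<in>V_3. (\<forall>\<alpha> \<beta>. zero_in \<omega> (weak_partial \<omega> \<alpha> (weak_partial \<omega> \<beta> u3))) \<longrightarrow> zero_in \<omega> u3)
       \<and> (\<forall>u\<in>V. zero_in \<omega> (strain \<omega> u)
            \<longrightarrow> (\<forall>\<alpha>. zero_in \<omega> (fst u \<alpha>)) \<and> zero_in \<omega> (snd u))"
proof (intro conjI ballI impI)
  have \<omega>s: "\<omega> \<in> sets lebesgue" using assms(3) by simp
  fix u3 assume u3: "u3 \<in> V_3" "\<forall>\<alpha> \<beta>. zero_in \<omega> (weak_partial \<omega> \<alpha> (weak_partial \<omega> \<beta> u3))"
  show "zero_in \<omega> u3"
    by (rule H10_zero_if_hessian_zero[OF assms(9) _ assms(1) \<omega>s]) (use u3 assms(7) in auto)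
next
  have \<omega>s: "\<omega> \<in> sets lebesgue" using assms(3) by simp
  fix u assume u: "u \<in> V" and strain: "zero_in \<omega> (strain \<omega> u)"
  obtain uH w where u_eq: "u = (uH, w)" by (cases u)
  with u assms have uH: "uH \<in> V_H" "\<And>\<alpha>. uH \<alpha> \<in> H1 \<omega>" and w: "w \<in> H10 \<omega>" "w \<in> H2 \<omega>"
    by auto
  have "w \<in> H1 \<omega>" using w by (simp add: H2_def)
  then have grad: "zero_in \<omega> (weak_partial \<omega> a w)" for a
    using very_weak_Monge_Ampere_uniqueness[OF assms(1-3) w]
      integral_cof_form_test_fun[OF assms(1) \<omega>s uH(2)] strain by (simp add: u_eq)
  have "zero_in \<omega> w"
    by (rule H10_zero_if_gradient_zero[OF w(1) assms(1) \<omega>s grad])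
  \<comment> \<open>Once the gradient of \<open>w\<close> vanishes, the strain reduces to the linear
    one, and the hypothesis on \<open>V_H\<close> applies.\<close>
  moreover have "zero_in \<omega> (\<lambda>x. weak_partial \<omega> \<alpha> (uH \<beta>) x + weak_partial \<omega> \<beta> (uH \<alpha>) x)" for \<alpha> \<beta>
    using strain grad[of \<alpha>] unfolding zero_in_def u_eq
  proof eventually_elim
    case (elim x)
    then have "strain \<omega> (uH, w) x $ \<alpha> $ \<beta> = 0" by simp
    with elim(2) show ?case by (simp add: strain_def)
  qed
  ultimately show "\<forall>\<alpha>. zero_in \<omega> (fst u \<alpha>)" "zero_in \<omega> (snd u)"
    using assms(8)[OF uH(1)] by (simp_all add: u_eq)
qed

end
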